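(* Let $f$ be a monotonic function with $\lim_{Q\to\infty}f(Q)=\infty$. Then there exists a Liouville number $\gamma$, depending only on $f$, such that for every $\psi:\mathbb{N}\to\mathbb{R}_{\ge0}$ satisfying at least one of $$\exists\,\varepsilon>0:\ \liminf_{Q\to\infty}\frac1{f(Q)}\sum_{q\le Q}\frac{\psi(q)\varphi(q)}{q\,\mathrm{Log}\,q\,(\mathrm{Log}\,\mathrm{Log}\,q)^{1+\varepsilon}}>0,$$ $$\exists\,\varepsilon>0:\ \liminf_{Q\to\infty}\frac1{f(Q)}\sum_{q\le Q}\frac{\psi(q)}{\mathrm{Log}\,q\,(\mathrm{Log}\,\mathrm{Log}\,q)^{2+\varepsilon}}>0,$$ for almost every $x\in\mathbb{R}$ there are infinitely many $q\in\mathbb{N}$ with $\|qx-\gamma\|\le\psi(q)$.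
   Context: $\mathrm{Log}(x):=\max\{1,\log x\}$ with $\log$ the natural logarithm. An irrational $\gamma$ is Liouville if for every $w>0$ the inequality $|\gamma-p/q|<q^{-w}$ holds for infinitely many $p,q\in\mathbb{Z}$, $q>0$. "Almost every" refers to Lebesgue measure; $\varphi$ is Euler's totient function; $\|y\|$ is the distance from $y$ to the nearest integer. *)

theory Defs
  imports "HOL-Analysis.Analysis" "HOL-Number_Theory.Number_Theory"
begin

definition Log :: "real \<Rightarrow> real" where
  "Log x = max 1 (ln x)"

definition dist_int :: "real \<Rightarrow> real" where
  "dist_int y = \<bar>y - of_int (round y)\<bar>"

definition liouville :: "real \<Rightarrow> bool" where
  "liouville \<gamma> \<longleftrightarrow> \<gamma> \<notin> \<rat> \<and>
     (\<forall>w>0. infinite {(p :: int, q :: int). q > 0 \<and> \<bar>\<gamma> - of_int p / of_int q\<bar> < of_int q powr (-w)})"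

end

theory Submission
  imports Defs "HOL-Real_Asymp.Real_Asymp"
begin

text \<open>
  Take \<open>\<gamma> = \<Sum>\<^sub>j 2\<^bsup>-n(j)\<^esup>\<close> with \<open>n\<close> growing extremely fast. In a range \<open>U\<^sub>j < q \<le> V\<^sub>j\<close> the number \<open>\<gamma>\<close>
  is then indistinguishable from a fraction \<open>a/r\<close>, \<open>r = 2\<^bsup>n(j)\<^esup>\<close>, and since \<open>V\<^sub>j\<close> may be chosen after
  \<open>U\<^sub>j\<close> so that \<open>f(V\<^sub>j)\<close> is huge, some block \<open>4\<^sup>k \<le> log q < 4\<^bsup>k+1\<^esup>\<close> inside the range carries mass
  \<open>\<Sum>\<psi>(q) \<ge> 2\<^sup>k\<close>. Only \<open>\<Sum>\<psi>(q)/Log q\<close> matters here; the totient and iterated logarithm are discarded.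

  For such a block consider the intervals \<open>[P/(rq), P/(rq) + \<psi>(q)/(\<theta>q)]\<close> with \<open>P \<equiv> a\<close> modulo \<open>r\<close>, keeping
  only those \<open>P\<close> with \<open>gcd(P,q) \<le> Y = 2\<^bsup>k/2\<^esup>\<close>. A sieve shows that a positive proportion of the \<open>P\<close>
  survives, in every short interval. The bound on the gcd makes every centre common to at most \<open>Y\<close> of the
  \<open>q\<close>, which is negligible against the mass. For distinct centres \<open>|Pq' - P'q| \<ge> gcd(q,q')\<close>, so the
  intervals of \<open>q\<close> and \<open>q'\<close> are quasi-independent up to a factor \<open>r\<close>, and this factor is lost only
  if \<open>lcm(q,q') max(\<psi>(q)/q, \<psi>(q')/q')\<close> lies in \<open>[\<theta>/r, \<theta>)\<close>. As the mass is enormous compared to \<open>r\<close>,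
  there is room to choose the scale \<open>\<theta>\<close> so that few pairs are affected. The resulting uniform second
  moment bound, together with equidistribution of the centres, forces the exceptional set to be null.
\<close>

section \<open>Sieving arithmetic progressions\<close>

lemma int_interval_eq: "{t::int. x \<le> real_of_int t \<and> real_of_int t < y} = {\<lceil>x\<rceil>..<\<lceil>y\<rceil>}"
  by (auto simp: ceiling_le_iff less_ceiling_iff)

lemma finite_int_interval: "finite {t::int. x \<le> real_of_int t \<and> real_of_int t < y \<and> Q t}"
  by (rule finite_subset[of _ "{\<lceil>x\<rceil>..<\<lceil>y\<rceil>}"]) (use int_interval_eq[of x y] in auto)

lemma card_int_interval:
  assumes "x \<le> y"
  shows "\<bar>real (card {t::int. x \<le> real_of_int t \<and> real_of_int t < y}) - (y - x)\<bar> \<le> 1"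
proof -
  have "\<lceil>x\<rceil> \<le> \<lceil>y\<rceil>" using assms by (rule ceiling_mono)
  then have "real (card {t::int. x \<le> real_of_int t \<and> real_of_int t < y}) = of_int \<lceil>y\<rceil> - of_int \<lceil>x\<rceil>"
    unfolding int_interval_eq by simp
  then show ?thesis by linarith
qed

text \<open>As \<open>e\<close> is coprime to \<open>m\<close>, the condition
  \<open>e dvd u + m * t\<close> singles out one residue class \<open>t0\<close> modulo
  \<open>e\<close>. Substituting \<open>t = t0 + e * s\<close> gives a progression of difference
  \<open>m * e\<close> over an interval shortened by the factor \<open>e\<close>. The predicate
  \<open>Q\<close> is arbitrary so that further sieve conditions are carried along.\<close>

lemma card_progression_reindex:
  fixes u m e :: int
  assumes "coprime e m" and "e > 0"
  obtains v s where
    "card {t::int. x \<le> real_of_int t \<and> real_of_int t < y \<and> e dvd u + m * t \<and> Q (u + m * t)}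
     = card {t::int. (x - s) / e \<le> real_of_int t \<and> real_of_int t < (y - s) / e \<and> Q (v + (m * e) * t)}"
proof -
  \<comment> \<open>\<open>k\<close> inverts \<open>m\<close> modulo \<open>e\<close>, so
    \<open>t0 = - u * k\<close> solves \<open>u + m * t0 = 0\<close> modulo
    \<open>e\<close>.\<close>
  obtain k where k: "[m * k = 1] (mod e)"
    using assms(1) cong_solve_coprime_int[of m e] by (auto simp: coprime_commute)
  define t0 where "t0 = - u * k"
  have t0: "e dvd u + m * t0"
  proof -
    have "[u + m * t0 = u + - u * (m * k)] (mod e)" by (simp add: t0_def algebra_simps)
    also have "[u + - u * (m * k) = u + - u * 1] (mod e)"
      by (intro cong_add cong_mult cong_refl k)
    finally show ?thesis by (simp add: cong_0_iff)
  qed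
  have dvd_iff: "e dvd u + m * t \<longleftrightarrow> e dvd t - t0" for t
  proof -
    have "e dvd u + m * t \<longleftrightarrow> e dvd (u + m * t) - (u + m * t0)" using t0 by (metis dvd_diff_commute dvd_diff_right_iff)
    also have "\<dots> \<longleftrightarrow> e dvd m * (t - t0)" by (simp add: algebra_simps)
    also have "\<dots> \<longleftrightarrow> e dvd t - t0" using assms(1) by (simp add: coprime_dvd_mult_right_iff)
    finally show ?thesis .
  qed
  have lo: "(x - of_int t0) / e \<le> real_of_int s \<longleftrightarrow> x \<le> real_of_int (t0 + e * s)"
    and up: "real_of_int s < (y - of_int t0) / e \<longleftrightarrow> real_of_int (t0 + e * s) < y"
    and eq: "u + m * (t0 + e * s) = (u + m * t0) + (m * e) * s" for s
    using assms(2) by (auto simp: pos_divide_le_eq pos_less_divide_eq algebra_simps)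
  have "bij_betw (\<lambda>s. t0 + e * s)
    {t::int. (x - of_int t0) / e \<le> real_of_int t \<and> real_of_int t < (y - of_int t0) / e \<and> Q ((u + m * t0) + (m * e) * t)}
    {t::int. x \<le> real_of_int t \<and> real_of_int t < y \<and> e dvd u + m * t \<and> Q (u + m * t)}"
    (is "bij_betw ?f ?A ?B")
  proof (rule bij_betwI')
    fix a b show "(?f a = ?f b) = (a = b)" using assms(2) by simp
  next
    fix a assume "a \<in> ?A"
    then show "?f a \<in> ?B" unfolding lo up mem_Collect_eq eq[symmetric] dvd_iff by simp
  next
    fix b assume b: "b \<in> ?B"
    then obtain s where "b - t0 = e * s" using dvd_iff by (auto elim: dvdE)
    then have "b = t0 + e * s" by simp
    moreover from this b have "s \<in> ?A" unfolding lo up mem_Collect_eq eq[symmetric] by simp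
    ultimately show "\<exists>a\<in>?A. b = ?f a" by blast
  qed
  from bij_betw_same_card[OF this, symmetric] show ?thesis by (rule that)
qed

text \<open>Legendre sieve by induction on the primes. The terms divisible by a new prime
  \<open>p\<close> form a progression over an interval shorter by the factor \<open>p\<close>.
  Subtracting them multiplies the main term by \<open>1 - 1 / p\<close>, while the two errors add up
  to twice the old bound.\<close>

lemma card_progression_coprime:
  fixes u m :: int
  assumes "finite S" and "\<And>p. p \<in> S \<Longrightarrow> prime p" and "\<And>p. p \<in> S \<Longrightarrow> coprime (int p) m" and "x \<le> y"
  shows "\<bar>real (card {t::int. x \<le> real_of_int t \<and> real_of_int t < y \<and> (\<forall>p\<in>S. \<not> int p dvd u + m * t)})
      - (y - x) * (\<Prod>p\<in>S. 1 - 1 / real p)\<bar> \<le> 2 ^ card S"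
  using assms
proof (induction S arbitrary: u m x y rule: finite_induct)
  case empty
  then show ?case using card_int_interval[of x y] by simp
next
  case (insert p S)
  let ?T = "\<lambda>R. {t::int. x \<le> real_of_int t \<and> real_of_int t < y \<and> R t}"
  let ?Q = "\<lambda>n. \<forall>p\<in>S. \<not> int p dvd n"
  have p: "prime p" "coprime (int p) m" "int p > 0" "real p > 0"
    using insert.prems by (auto simp: prime_gt_0_nat)
  obtain v s where vs: "card (?T (\<lambda>t. int p dvd u + m * t \<and> ?Q (u + m * t)))
     = card {t::int. (x - s) / int p \<le> real_of_int t \<and> real_of_int t < (y - s) / int p \<and> ?Q (v + (m * int p) * t)}"
    using card_progression_reindex[OF p(2,3), where Q = ?Q and x = x and y = y and u = u]
    by blast
  \<comment> \<open>Reindexing changes the difference to \<open>m * p\<close>, which must stay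
    coprime to the remaining primes for the induction hypothesis to apply.\<close>
  have cop: "coprime (int p') (m * int p)" if "p' \<in> S" for p'
  proof -
    have "prime p'" "p' \<noteq> p" using that insert by auto
    then have "coprime p' p" using p(1) primes_coprime by blast
    then show ?thesis using insert.prems(2)[of p'] that by auto
  qed
  have a: "\<bar>real (card (?T (\<lambda>t. ?Q (u + m * t)))) - (y - x) * (\<Prod>p\<in>S. 1 - 1 / real p)\<bar> \<le> 2 ^ card S"
    using insert by auto
  have b: "\<bar>real (card (?T (\<lambda>t. int p dvd u + m * t \<and> ?Q (u + m * t))))
     - ((y - s) / int p - (x - s) / int p) * (\<Prod>p\<in>S. 1 - 1 / real p)\<bar> \<le> 2 ^ card S"
    unfolding vs
    by (rule insert.IH) (use insert.prems cop p in \<open>auto intro!: divide_right_mono\<close>)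
  have "?T (\<lambda>t. ?Q (u + m * t)) = ?T (\<lambda>t. int p dvd u + m * t \<and> ?Q (u + m * t))
     \<union> ?T (\<lambda>t. \<forall>p\<in>insert p S. \<not> int p dvd u + m * t)" by auto
  moreover have "card (?T (\<lambda>t. int p dvd u + m * t \<and> ?Q (u + m * t))
     \<union> ?T (\<lambda>t. \<forall>p\<in>insert p S. \<not> int p dvd u + m * t)) = 
    card (?T (\<lambda>t. int p dvd u + m * t \<and> ?Q (u + m * t))) + card (?T (\<lambda>t. \<forall>p\<in>insert p S. \<not> int p dvd u + m * t))"
    by (intro card_Un_disjoint finite_int_interval) auto
  ultimately have c: "real (card (?T (\<lambda>t. \<forall>p\<in>insert p S. \<not> int p dvd u + m * t))) =
     real (card (?T (\<lambda>t. ?Q (u + m * t)))) - real (card (?T (\<lambda>t. int p dvd u + m * t \<and> ?Q (u + m * t))))"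
    by simp
  have "(y - x) * (\<Prod>p\<in>insert p S. 1 - 1 / real p) = (y - x) * (\<Prod>p\<in>S. 1 - 1 / real p)
     - ((y - s) / int p - (x - s) / int p) * (\<Prod>p\<in>S. 1 - 1 / real p)"
    using insert p by (simp add: field_simps)
  moreover have "(2::real) ^ card (insert p S) = 2 * 2 ^ card S" using insert by simp
  moreover have "\<bar>c' - Z\<bar> \<le> 2 * k" if "\<bar>a' - X\<bar> \<le> k" "\<bar>b' - Y\<bar> \<le> k" "c' = a' - b'" "Z = X - Y"
    for a' b' c' X Y Z k :: real using that by linarith
  ultimately show ?case using a b c by (metis (no_types, lifting))
qed

text \<open>Reindex by \<open>e\<close> first, then sieve. It is meant for \<open>e\<close> a power
  of a prime outside \<open>S\<close>, where divisibility by \<open>e\<close> costs exactly the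
  factor \<open>1 / e\<close> in the main term.\<close>

lemma card_progression_coprime_dvd:
  fixes u m e :: int
  assumes "finite S" and "\<And>p. p \<in> S \<Longrightarrow> prime p" and "\<And>p. p \<in> S \<Longrightarrow> coprime (int p) (m * e)" and "x \<le> y"
    and "coprime e m" and "e > 0"
  shows "real (card {t::int. x \<le> real_of_int t \<and> real_of_int t < y \<and> e dvd u + m * t
        \<and> (\<forall>p\<in>S. \<not> int p dvd u + m * t)})
      \<le> (y - x) / e * (\<Prod>p\<in>S. 1 - 1 / real p) + 2 ^ card S"
proof -
  let ?Q = "\<lambda>n. \<forall>p\<in>S. \<not> int p dvd n"
  obtain v s where vs: "card {t::int. x \<le> real_of_int t \<and> real_of_int t < y \<and> e dvd u + m * t \<and> ?Q (u + m * t)}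
     = card {t::int. (x - s) / e \<le> real_of_int t \<and> real_of_int t < (y - s) / e \<and> ?Q (v + (m * e) * t)}"
    using card_progression_reindex[OF assms(5,6), where Q = ?Q and x = x and y = y and u = u]
    by blast
  have "(x - s) / e \<le> (y - s) / e" using assms by (intro divide_right_mono) auto
  from card_progression_coprime[OF assms(1-3) this, of v]
  show ?thesis unfolding vs by (simp add: abs_le_iff diff_divide_distrib)
qed

section \<open>Elementary bounds on the prime factors of an integer\<close>

lemma prod_prime_factors_le:
  fixes n :: nat
  assumes "n > 0" shows "(\<Prod>p\<in>prime_factors n. p) \<le> n"
proof -
  have "(\<Prod>p\<in>prime_factors n. p) dvd (\<Prod>p\<in>prime_factors n. p ^ multiplicity p n)"
    by (intro prod_dvd_prod) (auto simp: prime_factors_multiplicity intro!: dvd_power)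
  then have "(\<Prod>p\<in>prime_factors n. p) dvd n" using prime_factorization_nat[of n] assms by simp
  then show ?thesis using assms dvd_imp_le by blast
qed

lemma sum_ln_prime_factors_le:
  assumes "n > 0" shows "(\<Sum>p\<in>prime_factors n. ln (real p)) \<le> ln (real n)"
proof -
  have le: "real (\<Prod>p\<in>prime_factors n. p) \<le> real n"
    using prod_prime_factors_le[OF assms] by (simp only: of_nat_le_iff)
  have pos: "\<And>p. p \<in> prime_factors n \<Longrightarrow> real p > 0" by (auto simp: prime_factors_multiplicity prime_gt_0_nat)
  have "(\<Sum>p\<in>prime_factors n. ln (real p)) = ln (\<Prod>p\<in>prime_factors n. real p)"
    using pos by (subst ln_prod) auto
  also have "\<dots> \<le> ln (real n)"
    using le assms prod_pos[of "prime_factors n" real] pos by (intro ln_mono) auto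
  finally show ?thesis .
qed

text \<open>Write \<^term>\<open>ln (fact n)\<close> as a sum over multiples of primes and use \<open>\<lfloor>n/p\<rfloor> \<ge> n/(2p)\<close>.\<close>
lemma sum_ln_over_primes_le:
  assumes "n \<ge> 1" shows "(\<Sum>p | prime p \<and> p \<le> n. ln (real p) / real p) \<le> 2 * ln (real n)"
proof -
  let ?P = "{p. prime p \<and> p \<le> n}"
  have fin: "finite ?P" by simp
  have card: "card {m\<in>{1..n}. p dvd m} \<ge> real n / (2 * real p)" if p: "p \<in> ?P" for p
  proof -
    have p0: "p > 0" "p \<le> n" using p prime_gt_0_nat by auto
    have eq: "{m\<in>{1..n}. p dvd m} = (\<lambda>k. p * k) ` {1..n div p}"
      using p0 by (auto simp: less_eq_div_iff_mult_less_eq mult.commute image_iff elim!: dvdE)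
        
    have "card {m\<in>{1..n}. p dvd m} = n div p"
      unfolding eq using p0 by (subst card_image) (auto simp: inj_on_def)
    moreover have "real n \<le> 2 * real p * real (n div p)"
    proof -
      have "n div p \<ge> 1" using p0 by (simp add: div_greater_zero_iff Suc_leI)
      then have "p \<le> p * (n div p)" by simp
      moreover have "n = p * (n div p) + n mod p" "n mod p < p" using p0 by auto
      ultimately have "n \<le> 2 * p * (n div p)" by linarith
      then have "real n \<le> real (2 * p * (n div p))" by (simp only: of_nat_le_iff)
      then show ?thesis by simp
    qed
    ultimately show ?thesis using p0 by (simp add: field_simps)
  qed
  have "real n / 2 * (\<Sum>p\<in>?P. ln (real p) / real p) = (\<Sum>p\<in>?P. ln (real p) * (real n / (2 * real p)))"
    by (simp add: sum_distrib_left algebra_simps)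
  also have "\<dots> \<le> (\<Sum>p\<in>?P. ln (real p) * real (card {m\<in>{1..n}. p dvd m}))"
    using card by (intro sum_mono mult_left_mono) (auto dest: prime_ge_1_nat)
  also have "\<dots> = (\<Sum>p\<in>?P. \<Sum>m\<in>{m\<in>{1..n}. p dvd m}. ln (real p))" by (simp add: mult.commute)
  also have "\<dots> = (\<Sum>m\<in>{1..n}. \<Sum>p\<in>{p\<in>?P. p dvd m}. ln (real p))"
    by (rule sum.swap_restrict) auto
  also have "\<dots> = (\<Sum>m\<in>{1..n}. \<Sum>p\<in>prime_factors m. ln (real p))"
    by (intro sum.cong refl) (auto simp: prime_factors_dvd dest: dvd_imp_le)
  also have "\<dots> \<le> (\<Sum>m\<in>{1..n}. ln (real n))"
  proof (rule sum_mono)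
    fix m assume "m \<in> {1..n}"
    then show "(\<Sum>p\<in>prime_factors m. ln (real p)) \<le> ln (real n)"
      using sum_ln_prime_factors_le[of m] by (auto intro: order_trans)
  qed
  also have "\<dots> = real n * ln (real n)" by simp
  finally show ?thesis using assms by (simp add: field_simps)
qed

text \<open>In \<open>4 ^ card (prime_factors q)\<close> every prime \<open>p \<ge> 4\<close>
  absorbs its own factor 4, and only 2 and 3 need an extra 4 each; hence the bound
  \<open>16 * q\<close>, whose square root is taken. This keeps the sieve error of size about
  \<open>sqrt q\<close>.\<close>

lemma two_power_prime_factors_le:
  fixes q :: nat
  assumes "q > 0" shows "2 ^ card (prime_factors q) \<le> 4 * sqrt (real q)"
proof -
  let ?c = "\<lambda>p::nat. if p < 4 then 4 else 1 :: nat"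
  have "(4::nat) ^ card (prime_factors q) = (\<Prod>p\<in>prime_factors q. 4)" by simp
  also have "\<dots> \<le> (\<Prod>p\<in>prime_factors q. ?c p * p)"
    by (intro prod_mono) (auto simp: prime_factors_multiplicity prime_gt_0_nat Suc_leI)
  also have "\<dots> = (\<Prod>p\<in>prime_factors q. ?c p) * (\<Prod>p\<in>prime_factors q. p)"
    by (rule prod.distrib)
  also have "\<dots> \<le> 16 * q"
  proof (intro mult_mono prod_prime_factors_le assms)
    have sub: "{p \<in> prime_factors q. p < 4} \<subseteq> {2, 3}"
      by (auto simp: prime_factors_multiplicity dest: prime_ge_2_nat)
    have "(\<Prod>p\<in>prime_factors q. ?c p) = (\<Prod>p\<in>{p \<in> prime_factors q. p < 4}. 4)"
      by (intro prod.mono_neutral_cong_right) auto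
    also have "\<dots> = 4 ^ card {p \<in> prime_factors q. p < 4}" by simp
    also have "\<dots> \<le> 4 ^ 2" using card_mono[OF _ sub] by (intro power_increasing) auto
    finally show "(\<Prod>p\<in>prime_factors q. ?c p) \<le> 16" by simp
  qed auto
  finally have "real (4 ^ card (prime_factors q)) \<le> real (16 * q)" by (simp only: of_nat_le_iff)
  then have "(2 ^ card (prime_factors q) / 4)\<^sup>2 \<le> real q"
    by (simp add: power2_eq_square flip: power_mult_distrib)
  then have "2 ^ card (prime_factors q) / 4 \<le> sqrt (real q)" by (rule real_le_rsqrt)
  then show ?thesis by simp
qed

lemma card_prime_factors_le_ln:
  fixes q :: nat
  assumes "q > 0" shows "real (card (prime_factors q)) \<le> 2 * ln (real q)"
proof -
  have "real (card (prime_factors q)) * (1 / 2) = (\<Sum>p\<in>prime_factors q. 1 / 2)" by simp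
  also have "\<dots> \<le> (\<Sum>p\<in>prime_factors q. ln (real p))"
  proof (rule sum_mono)
    fix p assume "p \<in> prime_factors q"
    then have "real 2 \<le> real p" by (simp only: of_nat_le_iff) (auto simp: prime_factors_multiplicity prime_ge_2_nat)
    then have "ln 2 \<le> ln (real p)" by (intro ln_mono) auto
    then show "1 / 2 \<le> ln (real p)" using ln2_ge_two_thirds by linarith
  qed
  also have "\<dots> \<le> ln (real q)" using sum_ln_prime_factors_le assms by simp
  finally show ?thesis by simp
qed

lemma sum_ln_over_primes_le_real:
  assumes "w \<ge> 1"
  shows "finite {p. prime p \<and> real p \<le> w}"
    and "(\<Sum>p | prime p \<and> real p \<le> w. ln (real p) / real p) \<le> 2 * ln w"
proof -
  have eq: "{p. prime p \<and> real p \<le> w} = {p. prime p \<and> p \<le> nat \<lfloor>w\<rfloor>}"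
    using assms by (auto simp: le_nat_floor) (meson le_nat_floor of_nat_floor of_nat_le_iff order_trans zero_le_one)+
  show "finite {p. prime p \<and> real p \<le> w}" unfolding eq by simp
  have "nat \<lfloor>w\<rfloor> \<ge> 1" "real (nat \<lfloor>w\<rfloor>) \<le> w" using assms by (auto simp: le_nat_floor)
  then have "ln (real (nat \<lfloor>w\<rfloor>)) \<le> ln w" by (intro ln_mono) auto
  then show "(\<Sum>p | prime p \<and> real p \<le> w. ln (real p) / real p) \<le> 2 * ln w"
    unfolding eq using sum_ln_over_primes_le[OF \<open>nat \<lfloor>w\<rfloor> \<ge> 1\<close>] by linarith
qed

text \<open>Let \<open>L = exp (32 * h)\<close>. Primes in \<open>(exp h, L]\<close> satisfy
  \<open>ln p \<ge> h\<close>, so their sum is at most \<open>2 * ln L / h = 64\<close>. There are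
  at most \<open>2 * ln q < 8 * L\<close> primes above \<open>L\<close>, each contributing at most
  \<open>1 / L\<close>, which adds 8. The bound depends on neither \<open>h\<close> nor
  \<open>q\<close>.\<close>

lemma sum_inverse_prime_factors_le:
  fixes q :: nat and h :: real
  assumes "h \<ge> 1" and "exp (32 * h) \<le> ln (real q)" and "ln (real q) < 4 * exp (32 * h)"
  shows "(\<Sum>p | p \<in> prime_factors q \<and> real p > exp h. 1 / real p) \<le> 72"
proof -
  let ?L = "exp (32 * h)"
  have "real q > 0" using assms(2) exp_gt_zero[of "32 * h"] by (cases "q = 0") auto
  then have q: "q > 0" by simp
  have pr: "prime p" "real p > 0" if "p \<in> prime_factors q" for p
    using that by (auto simp: prime_factors_multiplicity prime_gt_0_nat)
  let ?M = "{p \<in> prime_factors q. real p > exp h \<and> real p \<le> ?L}"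
  let ?B = "{p \<in> prime_factors q. real p > ?L}"
  have "(\<Sum>p\<in>?M. 1 / real p) * h \<le> (\<Sum>p\<in>?M. ln (real p) / real p)"
    unfolding sum_distrib_right
  proof (rule sum_mono)
    fix p assume p: "p \<in> ?M"
    then have "ln (exp h) \<le> ln (real p)" by (intro ln_mono) auto
    then show "1 / real p * h \<le> ln (real p) / real p" using pr[of p] p by (simp add: divide_right_mono)
  qed
  also have "\<dots> \<le> (\<Sum>p | prime p \<and> real p \<le> ?L. ln (real p) / real p)"
    using assms(1) sum_ln_over_primes_le_real(1)[of ?L] pr
    by (intro sum_mono2) (auto intro!: divide_nonneg_nonneg ln_ge_zero Suc_leI prime_gt_0_nat)
  also have "\<dots> \<le> 2 * ln ?L" using assms(1) by (intro sum_ln_over_primes_le_real) auto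
  also have "\<dots> = 64 * h" by simp
  finally have M: "(\<Sum>p\<in>?M. 1 / real p) \<le> 64" using assms(1) by simp
  have "(\<Sum>p\<in>?B. 1 / real p) \<le> (\<Sum>p\<in>?B. 1 / ?L)"
    by (intro sum_mono divide_left_mono) (auto simp: prime_factors_multiplicity prime_gt_0_nat)
  also have "\<dots> = real (card ?B) / ?L" by simp
  also have "\<dots> \<le> (2 * ln (real q)) / ?L"
    using card_mono[of "prime_factors q" ?B] card_prime_factors_le_ln[OF q]
    by (intro divide_right_mono) (auto intro!: order_trans[OF _ card_prime_factors_le_ln[OF q]])
  also have "\<dots> \<le> 8" using assms(3) by (simp add: field_simps)
  finally have B: "(\<Sum>p\<in>?B. 1 / real p) \<le> 8" .
  have hL: "exp h \<le> ?L" using assms(1) by simp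
  have "{p. p \<in> prime_factors q \<and> real p > exp h} = ?M \<union> ?B"
    using le_less_trans[OF hL] by (auto simp del: exp_le_cancel_iff exp_less_cancel_iff)
  then have "(\<Sum>p | p \<in> prime_factors q \<and> real p > exp h. 1 / real p) = (\<Sum>p\<in>?M. 1 / real p) + (\<Sum>p\<in>?B. 1 / real p)"
    by (simp only:) (intro sum.union_disjoint, auto)
  with M B show ?thesis by simp
qed

section \<open>From sieve products to progressions with small gcd\<close>

lemma exp_neg_double_le:
  assumes "0 \<le> x" and "x \<le> 1 / 2" shows "exp (- 2 * x) \<le> 1 - (x::real)"
proof -
  have "1 \<le> (1 - x) * (1 + 2 * x)"
  proof -
    have "x * (1 - 2 * x) \<ge> 0" using assms by (intro mult_nonneg_nonneg) auto
    then show ?thesis by (simp add: algebra_simps)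
  qed
  also have "\<dots> \<le> (1 - x) * exp (2 * x)"
    using assms by (intro mult_left_mono exp_ge_add_one_self) auto
  finally show ?thesis by (simp add: exp_minus field_simps)
qed

text \<open>The exponent of \<open>p\<close> in the gcd counts the powers \<open>p ^ i\<close> with
  \<open>i \<ge> 1\<close> dividing both numbers. Writing \<open>ln gcd\<close> as a sum over prime
  powers makes it possible to average over \<open>P\<close> by exchanging sums.\<close>

lemma ln_gcd_le:
  fixes q :: nat and P :: int
  assumes "q > 0"
  shows "ln (real_of_int (gcd P (int q))) \<le>
    (\<Sum>p | p \<in> prime_factors q \<and> int p dvd P. \<Sum>i | i \<in> {1..multiplicity p q} \<and> int p ^ i dvd P. ln (real p))"
proof -
  define g where "g = gcd (nat \<bar>P\<bar>) q"
  have "int g = gcd (int (nat \<bar>P\<bar>)) (int q)" unfolding g_def by (rule gcd_int_int_eq[symmetric])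
  then have g: "gcd P (int q) = int g" by simp
  have g': "g > 0" "g dvd q" unfolding g_def by (use assms in \<open>simp add: gcd_pos_nat\<close>) (rule gcd_dvd2)
  have gP: "int g dvd P" unfolding g[symmetric] by simp
  have pos: "real p > 0" "prime p" if "p \<in> prime_factors g" for p
    using that by (auto simp: prime_factors_multiplicity prime_gt_0_nat)
  have "real g = real (\<Prod>p\<in>prime_factors g. p ^ multiplicity p g)"
    using prime_factorization_nat[of g] g'(1) by simp
  also have "\<dots> = (\<Prod>p\<in>prime_factors g. real p ^ multiplicity p g)"
    by (simp only: of_nat_prod of_nat_power)
  finally have "real g = (\<Prod>p\<in>prime_factors g. real p ^ multiplicity p g)" .
  then have "ln (real g) = (\<Sum>p\<in>prime_factors g. ln (real p ^ multiplicity p g))"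
    using pos by (simp add: ln_prod)
  also have "\<dots> = (\<Sum>p\<in>prime_factors g. real (multiplicity p g) * ln (real p))"
    by (simp add: ln_realpow)
  also have "\<dots> \<le> (\<Sum>p\<in>prime_factors g. \<Sum>i | i \<in> {1..multiplicity p q} \<and> int p ^ i dvd P. ln (real p))"
  proof (rule sum_mono)
    fix p assume p: "p \<in> prime_factors g"
    have "{1..multiplicity p g} \<subseteq> {i. i \<in> {1..multiplicity p q} \<and> int p ^ i dvd P}"
    proof safe
      fix i assume i: "i \<in> {1..multiplicity p g}"
      then have d: "p ^ i dvd g" by (intro multiplicity_dvd') auto
      then have "p ^ i dvd q" using g'(2) by (rule dvd_trans)
      then show "i \<in> {1..multiplicity p q}" using i assms pos[OF p]
        by (auto intro!: multiplicity_geI dest: not_prime_unit)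
      from d have "int (p ^ i) dvd int g" by (simp only: int_dvd_int_iff)
      with gP show "int p ^ i dvd P" by (metis dvd_trans of_nat_power)
    qed
    then have "card {1..multiplicity p g} \<le> card {i. i \<in> {1..multiplicity p q} \<and> int p ^ i dvd P}"
      by (intro card_mono) auto
    then show "real (multiplicity p g) * ln (real p) \<le> (\<Sum>i | i \<in> {1..multiplicity p q} \<and> int p ^ i dvd P. ln (real p))"
      using pos[OF p] prime_ge_1_nat[of p] by (auto intro!: mult_right_mono)
  qed
  also have "\<dots> \<le> (\<Sum>p | p \<in> prime_factors q \<and> int p dvd P. \<Sum>i | i \<in> {1..multiplicity p q} \<and> int p ^ i dvd P. ln (real p))"
  proof (rule sum_mono2)
    show "prime_factors g \<subseteq> {p \<in> prime_factors q. int p dvd P}"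
      using g' gP assms by (auto simp: prime_factors_dvd intro: dvd_trans)
    show "0 \<le> (\<Sum>i | i \<in> {1..multiplicity p q} \<and> int p ^ i dvd P. ln (real p))"
      if "p \<in> {p \<in> prime_factors q. int p dvd P} - prime_factors g" for p
      using that by (intro sum_nonneg ln_ge_zero) (auto simp: prime_factors_multiplicity dest: prime_ge_1_nat)
  qed auto
  finally show ?thesis using g by simp
qed

lemma sum_inverse_powers_le:
  fixes z :: real
  assumes "0 \<le> z" and "z \<le> 1 / 2" shows "(\<Sum>i=1..n. z ^ i) \<le> 2 * z"
proof -
  have "(\<Sum>i=1..n. z ^ i) \<le> 2 * z * (1 - (1 / 2) ^ n)"
  proof (induction n)
    case (Suc n)
    have "z ^ n \<le> (1 / 2) ^ n" using assms by (intro power_mono) auto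
    then have "z * z ^ n \<le> z * (1 / 2) ^ n" using assms by (intro mult_left_mono) auto
    with Suc show ?case by (simp add: algebra_simps)
  qed simp
  also have "\<dots> \<le> 2 * z * 1" using assms by (intro mult_left_mono) auto
  finally show ?thesis by simp
qed

lemma sum_multiplicity_ln:
  fixes q :: nat
  assumes "q > 0"
  shows "(\<Sum>p\<in>prime_factors q. real (multiplicity p q) * ln (real p)) = ln (real q)"
proof -
  have pos: "real p > 0" if "p \<in> prime_factors q" for p
    using that by (auto simp: prime_factors_multiplicity prime_gt_0_nat)
  have "real q = real (\<Prod>p\<in>prime_factors q. p ^ multiplicity p q)"
    using prime_factorization_nat[of q] assms by simp
  also have "\<dots> = (\<Prod>p\<in>prime_factors q. real p ^ multiplicity p q)"
    by (simp only: of_nat_prod of_nat_power)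
  finally have "real q = (\<Prod>p\<in>prime_factors q. real p ^ multiplicity p q)" .
  then have "ln (real q) = (\<Sum>p\<in>prime_factors q. ln (real p ^ multiplicity p q))"
    using pos by (simp add: ln_prod)
  then show ?thesis by (simp add: ln_realpow)
qed

text \<open>Only the primes of \<open>q\<close> above \<open>exp h\<close> are sieved out, which
  keeps a proportion bounded below by a constant. On the survivors \<open>ln gcd\<close> is then at
  most \<open>4 * h\<close> on average, up to sieve errors, so by Markov's inequality about half of
  them have gcd at most \<open>exp (8 * h)\<close>. Demanding full coprimality would instead lose a
  factor of the size of \<phi>(q)/q.\<close>

lemma card_small_gcd_ge:
  fixes q :: nat and a r :: int and h x y :: real
  assumes h: "h \<ge> 1" "exp (32 * h) \<le> ln (real q)" "ln (real q) < 4 * exp (32 * h)"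
    and cop: "coprime a r" and xy: "x \<le> y"
  shows "(y - x) * exp (- 144) / 2 - 4 * sqrt (real q) * (1 + ln (real q))
    \<le> real (card {t::int. x \<le> real_of_int t \<and> real_of_int t < y \<and> real_of_int (gcd (a + r * t) (int q)) \<le> exp (8 * h)})"
proof -
  have "real q > 0" using h(2) exp_gt_zero[of "32 * h"] by (cases "q = 0") auto
  then have q: "q > 0" by simp
  define S1 where "S1 = {p \<in> prime_factors q. real p > exp h \<and> coprime (int p) r}"
  define S2 where "S2 = {p \<in> prime_factors q. real p \<le> exp h \<and> coprime (int p) r}"
  define \<rho> where "\<rho> = (\<Prod>p\<in>S1. 1 - 1 / real p)"
  define A where "A = {t::int. x \<le> real_of_int t \<and> real_of_int t < y \<and> (\<forall>p\<in>S1. \<not> int p dvd a + r * t)}"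
  let ?g = "\<lambda>t. gcd (a + r * t) (int q)"
  define Bad where "Bad = {t \<in> A. real_of_int (?g t) > exp (8 * h)}"
  have fin: "finite S1" "finite S2" "finite A" "finite Bad"
    by (auto simp: S1_def S2_def A_def Bad_def finite_int_interval)
  have pr: "prime p" "p \<ge> 2" if "p \<in> prime_factors q" for p
    using that by (auto simp: prime_factors_multiplicity dest: prime_ge_2_nat)
  have half: "1 / real p \<le> 1 / 2" if "p \<in> prime_factors q" for p
    using pr(2)[OF that] by (simp add: field_simps)

  \<comment> \<open>The constant is \<open>2 * 72\<close>: each factor \<open>1 - 1 / p\<close> is
    at least \<open>exp (- 2 / p)\<close>, and the sum of \<open>1 / p\<close> is at most
    72.\<close>
  have Pi_ge: "exp (- 144) \<le> \<rho>"
  proof -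
    have "(\<Sum>p\<in>S1. 1 / real p) \<le> (\<Sum>p | p \<in> prime_factors q \<and> real p > exp h. 1 / real p)"
      by (intro sum_mono2) (auto simp: S1_def)
    also have "\<dots> \<le> 72" using h by (rule sum_inverse_prime_factors_le)
    finally have "- 144 \<le> - 2 * (\<Sum>p\<in>S1. 1 / real p)" by simp
    then have "exp (- 144) \<le> exp (\<Sum>p\<in>S1. - 2 * (1 / real p))"
      unfolding sum_distrib_left exp_le_cancel_iff .
    also have "\<dots> = (\<Prod>p\<in>S1. exp (- 2 * (1 / real p)))" using fin(1) by (rule exp_sum)
    also have "\<dots> \<le> \<rho>" unfolding \<rho>_def using half
      by (intro prod_mono conjI exp_neg_double_le) (auto simp: S1_def)
    finally show ?thesis .
  qed
  have Pi0: "0 \<le> \<rho>" using Pi_ge exp_gt_zero[of "- 144::real"] by linarith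
  define e where "e = (2::real) ^ card S1"
  have e: "0 \<le> e" "e \<le> 4 * sqrt (real q)"
  proof -
    have "card S1 \<le> card (prime_factors q)" by (intro card_mono) (auto simp: S1_def)
    then have "e \<le> 2 ^ card (prime_factors q)" unfolding e_def by (intro power_increasing) auto
    with two_power_prime_factors_le[OF q] show "e \<le> 4 * sqrt (real q)" by linarith
  qed (simp add: e_def)
  have cardA: "(y - x) * \<rho> - e \<le> real (card A)"
  proof -
    have "\<bar>real (card A) - (y - x) * \<rho>\<bar> \<le> e"
      unfolding A_def \<rho>_def e_def
      by (rule card_progression_coprime) (use fin xy pr in \<open>auto simp: S1_def\<close>)
    then show ?thesis by linarith
  qed

  \<comment> \<open>For a surviving \<open>t\<close>, every prime dividing both \<open>q\<close> and
    \<open>a + r * t\<close> lies in \<open>S2\<close>: those in \<open>S1\<close> were sieved out,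
    and a prime dividing \<open>r\<close> would also divide \<open>a\<close>.\<close>
  have ln_g: "ln (real_of_int (?g t)) \<le> (\<Sum>p\<in>S2. \<Sum>i | i \<in> {1..multiplicity p q} \<and> int p ^ i dvd a + r * t. ln (real p))"
    if t: "t \<in> A" for t
  proof -
    have "ln (real_of_int (?g t)) \<le> (\<Sum>p | p \<in> prime_factors q \<and> int p dvd a + r * t.
       \<Sum>i | i \<in> {1..multiplicity p q} \<and> int p ^ i dvd a + r * t. ln (real p))"
      using ln_gcd_le[OF q] .
    also have "\<dots> \<le> (\<Sum>p\<in>S2. \<Sum>i | i \<in> {1..multiplicity p q} \<and> int p ^ i dvd a + r * t. ln (real p))"
    proof (rule sum_mono2[OF fin(2)])
      show "{p \<in> prime_factors q. int p dvd a + r * t} \<subseteq> S2"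
      proof safe
        fix p assume p: "p \<in> prime_factors q" "int p dvd a + r * t"
        have "coprime (int p) r"
        proof (rule ccontr)
          assume "\<not> coprime (int p) r"
          then have "int p dvd r" using pr(1)[OF p(1)] prime_imp_coprime[of "int p" r] by auto
          moreover from this p(2) have "int p dvd a" by (simp add: dvd_add_left_iff)
          ultimately have "is_unit (int p)" using cop by (meson coprime_common_divisor)
          then show False using pr(2)[OF p(1)] by simp
        qed
        then show "p \<in> S2" using t p unfolding A_def S1_def S2_def by fastforce
      qed
      show "0 \<le> (\<Sum>i | i \<in> {1..multiplicity p q} \<and> int p ^ i dvd a + r * t. ln (real p))"
        if "p \<in> S2 - {p \<in> prime_factors q. int p dvd a + r * t}" for p
        using that pr(2)[of p] by (intro sum_nonneg ln_ge_zero) (auto simp: S2_def)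
    qed
    finally show ?thesis .
  qed

  \<comment> \<open>Markov's inequality for \<open>ln gcd\<close>: the sum over \<open>Bad\<close>
    is bounded by the sum over all of \<open>A\<close>, which is then rearranged into counts over
    prime powers.\<close>
  have "8 * h * real (card Bad) = (\<Sum>t\<in>Bad. 8 * h)" by simp
  also have "\<dots> \<le> (\<Sum>t\<in>Bad. ln (real_of_int (?g t)))"
  proof (rule sum_mono)
    fix t assume "t \<in> Bad"
    then have "exp (8 * h) < real_of_int (?g t)" by (simp add: Bad_def)
    then have "ln (exp (8 * h)) \<le> ln (real_of_int (?g t))" by (intro ln_mono) auto
    then show "8 * h \<le> ln (real_of_int (?g t))" by simp
  qed
  also have "\<dots> \<le> (\<Sum>t\<in>A. ln (real_of_int (?g t)))"
  proof (intro sum_mono2 fin ln_ge_zero)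
    fix t
    have "?g t > 0" using q by simp
    then show "1 \<le> real_of_int (?g t)" by linarith
  qed (auto simp: Bad_def)
  also have "\<dots> \<le> (\<Sum>t\<in>A. \<Sum>p\<in>S2. \<Sum>i | i \<in> {1..multiplicity p q} \<and> int p ^ i dvd a + r * t. ln (real p))"
    by (intro sum_mono ln_g)
  also have "\<dots> = (\<Sum>p\<in>S2. \<Sum>t\<in>A. \<Sum>i | i \<in> {1..multiplicity p q} \<and> int p ^ i dvd a + r * t. ln (real p))"
    by (rule sum.swap)
  also have "\<dots> = (\<Sum>p\<in>S2. \<Sum>i=1..multiplicity p q. \<Sum>t | t \<in> A \<and> int p ^ i dvd a + r * t. ln (real p))"
    by (intro sum.cong refl sum.swap_restrict fin) auto
  also have "\<dots> = (\<Sum>p\<in>S2. \<Sum>i=1..multiplicity p q. real (card {t \<in> A. int p ^ i dvd a + r * t}) * ln (real p))"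
    by simp
  also have "\<dots> \<le> (\<Sum>p\<in>S2. \<Sum>i=1..multiplicity p q. ((y - x) * \<rho> * (1 / real p) ^ i + e) * ln (real p))"
  proof (intro sum_mono mult_right_mono)
    fix p i assume p: "p \<in> S2"
    then have p': "p \<in> prime_factors q" "coprime (int p) r" "real p \<le> exp h" by (auto simp: S2_def)
    show "0 \<le> ln (real p)" using pr(2)[OF p'(1)] by simp
    \<comment> \<open>The sieve by \<open>S1\<close> runs inside the class divisible by
      \<open>p ^ i\<close>. Since \<open>p\<close> belongs to \<open>S2\<close>, it is distinct from
      all sieving primes.\<close>
    have "real (card {t::int. x \<le> real_of_int t \<and> real_of_int t < y \<and> int p ^ i dvd a + r * t
        \<and> (\<forall>p\<in>S1. \<not> int p dvd a + r * t)})
      \<le> (y - x) / real_of_int (int p ^ i) * (\<Prod>p\<in>S1. 1 - 1 / real p) + 2 ^ card S1"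
    proof (rule card_progression_coprime_dvd)
      fix p' assume p1: "p' \<in> S1"
      then have "p' \<noteq> p" "prime p'" using p' pr by (auto simp: S1_def)
      then have "coprime p' p" using pr(1)[OF p'(1)] primes_coprime by blast
      then show "coprime (int p') (r * int p ^ i)" using p1 by (simp add: S1_def)
    qed (use fin xy pr p' in \<open>auto simp: S1_def prime_gt_0_nat\<close>)
    moreover have "{t \<in> A. int p ^ i dvd a + r * t} = {t::int. x \<le> real_of_int t \<and> real_of_int t < y \<and> int p ^ i dvd a + r * t
        \<and> (\<forall>p\<in>S1. \<not> int p dvd a + r * t)}" by (auto simp: A_def)
    ultimately show "real (card {t \<in> A. int p ^ i dvd a + r * t}) \<le> (y - x) * \<rho> * (1 / real p) ^ i + e"
      by (simp add: \<rho>_def e_def power_one_over field_simps)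
  qed
  also have "\<dots> = (\<Sum>p\<in>S2. ((y - x) * \<rho> * ln (real p)) * (\<Sum>i=1..multiplicity p q. (1 / real p) ^ i))
      + e * (\<Sum>p\<in>S2. real (multiplicity p q) * ln (real p))"
  proof -
    have "(\<Sum>i=1..n. (K * z i + e) * l) = (K * l) * (\<Sum>i=1..n. z i) + e * (real n * l)"
      for K l :: real and z :: "nat \<Rightarrow> real" and n
      by (induction n) (simp_all add: algebra_simps)
    then show ?thesis by (simp only: sum.distrib sum_distrib_left[where r = e and A = S2])
  qed
  also have "\<dots> \<le> (\<Sum>p\<in>S2. ((y - x) * \<rho> * ln (real p)) * (2 * (1 / real p))) + e * ln (real q)"
  proof (rule add_mono)
    show "(\<Sum>p\<in>S2. ((y - x) * \<rho> * ln (real p)) * (\<Sum>i=1..multiplicity p q. (1 / real p) ^ i))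
      \<le> (\<Sum>p\<in>S2. ((y - x) * \<rho> * ln (real p)) * (2 * (1 / real p)))"
      using xy Pi0 pr(2) half
      by (intro sum_mono mult_left_mono sum_inverse_powers_le mult_nonneg_nonneg ln_ge_zero)
        (force simp: S2_def)+
    have "(\<Sum>p\<in>S2. real (multiplicity p q) * ln (real p)) \<le> (\<Sum>p\<in>prime_factors q. real (multiplicity p q) * ln (real p))"
      using pr(2) by (intro sum_mono2 mult_nonneg_nonneg ln_ge_zero) (force simp: S2_def)+
    then show "e * (\<Sum>p\<in>S2. real (multiplicity p q) * ln (real p)) \<le> e * ln (real q)"
      unfolding sum_multiplicity_ln[OF q] using e(1) by (intro mult_left_mono)
  qed
  also have "(\<Sum>p\<in>S2. ((y - x) * \<rho> * ln (real p)) * (2 * (1 / real p))) = 2 * (y - x) * \<rho> * (\<Sum>p\<in>S2. ln (real p) / real p)"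
    unfolding sum_distrib_left by (intro sum.cong) auto
  also have "\<dots> \<le> 2 * (y - x) * \<rho> * (2 * h)"
  proof (rule mult_left_mono)
    have "(\<Sum>p\<in>S2. ln (real p) / real p) \<le> (\<Sum>p | prime p \<and> real p \<le> exp h. ln (real p) / real p)"
      using h(1) sum_ln_over_primes_le_real(1)[of "exp h"] pr
      by (intro sum_mono2) (auto simp: S2_def intro!: divide_nonneg_nonneg ln_ge_zero Suc_leI prime_gt_0_nat)
    also have "\<dots> \<le> 2 * ln (exp h)" using h(1) by (intro sum_ln_over_primes_le_real) auto
    finally show "(\<Sum>p\<in>S2. ln (real p) / real p) \<le> 2 * h" by simp
  qed (use xy Pi0 in auto)
  finally have "8 * h * real (card Bad) \<le> 4 * h * ((y - x) * \<rho>) + e * ln (real q)"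
    by (simp add: algebra_simps)
  \<comment> \<open>The error is inflated by \<open>8 * h \<ge> 1\<close> so that \<open>h\<close>
    can be cancelled from the whole inequality.\<close>
  also have "e * ln (real q) \<le> 8 * h * (e * ln (real q))"
  proof -
    have "0 \<le> e * ln (real q)" using e(1) q by simp
    then show ?thesis using h(1) mult_right_mono[of 1 "8 * h" "e * ln (real q)"] by simp
  qed
  finally have "h * (8 * real (card Bad)) \<le> h * (4 * ((y - x) * \<rho>) + 8 * (e * ln (real q)))"
    by (simp add: algebra_simps)
  then have bad: "8 * real (card Bad) \<le> 4 * ((y - x) * \<rho>) + 8 * (e * ln (real q))" using h(1) by simp
  let ?G = "{t::int. x \<le> real_of_int t \<and> real_of_int t < y \<and> real_of_int (?g t) \<le> exp (8 * h)}"
  have "A \<subseteq> ?G \<union> Bad" by (auto simp: A_def Bad_def)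
  then have "card A \<le> card (?G \<union> Bad)" using fin finite_int_interval by (intro card_mono) auto
  also have "\<dots> \<le> card ?G + card Bad" by (rule card_Un_le)
  finally have "real (card A) \<le> real (card ?G) + real (card Bad)" by linarith
  then have "(y - x) * \<rho> / 2 - e * (1 + ln (real q)) \<le> real (card ?G)"
    using bad cardA by (simp add: algebra_simps)
  moreover have "(y - x) * exp (- 144) / 2 \<le> (y - x) * \<rho> / 2"
    using xy Pi_ge by (intro divide_right_mono mult_left_mono) auto
  moreover have "e * (1 + ln (real q)) \<le> 4 * sqrt (real q) * (1 + ln (real q))"
    using e q by (intro mult_right_mono) auto
  ultimately show ?thesis by linarith
qed

section \<open>Overlaps\<close>

text \<open>The points \<open>P / (r * q)\<close> are the solutions in [0, 1) of
  \<open>q * x = a / r\<close> modulo 1. The gcd condition limits how many denominators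
  \<open>q\<close> can share one such point.\<close>

definition centres :: "int \<Rightarrow> int \<Rightarrow> real \<Rightarrow> nat \<Rightarrow> int set" where
  "centres a r Y q = {P. 0 \<le> P \<and> P < r * int q \<and> [P = a] (mod r) \<and> real_of_int (gcd P (int q)) \<le> Y}"

lemma finite_centres [simp]: "finite (centres a r Y q)"
  by (rule finite_subset[of _ "{0..<r * int q}"]) (auto simp: centres_def)

text \<open>Division by \<open>m\<close> is injective on a residue class and maps \<open>A\<close>
  into \<open>{0..<d}\<close>.\<close>

lemma card_residue_class_le:
  fixes m :: int
  assumes "m > 0" and "A \<subseteq> {0..<m * int d}" and "\<And>x y. x \<in> A \<Longrightarrow> y \<in> A \<Longrightarrow> [x = y] (mod m)"
  shows "card A \<le> d"
proof -
  have "inj_on (\<lambda>x. x div m) A"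
    by (rule inj_onI) (metis assms(3) cong_def div_mult_mod_eq)
  moreover have "(\<lambda>x. x div m) ` A \<subseteq> {0..<int d}"
  proof safe
    fix x assume "x \<in> A"
    then have "0 \<le> x" "x < int d * m" using assms(2) by (auto simp: mult.commute)
    moreover have "x div m < int d"
    proof (rule ccontr)
      assume "\<not> x div m < int d"
      then have "int d * m \<le> x div m * m" using assms(1) by (intro mult_right_mono) auto
      also have "\<dots> \<le> x" using assms(1) by (simp add: minus_mod_eq_div_mult[symmetric])
      finally show False using \<open>x < int d * m\<close> by simp
    qed
    ultimately show "x div m \<in> {0..<int d}"
      using assms(1) by (auto simp: pos_imp_zdiv_nonneg_iff)
  qed
  ultimately have "card A \<le> card {0..<int d}" by (intro card_inj_on_le) auto
  then show ?thesis by simp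
qed

lemma card_centres_le:
  assumes "r > 0" shows "card (centres a r Y q) \<le> q"
  using assms by (intro card_residue_class_le[of r])
    (auto simp: centres_def intro: cong_trans cong_sym)

lemma dvd_of_dvd_coprime_multiples:
  fixes a b r t :: int
  assumes "coprime a b" and "r dvd a * t" and "r dvd b * t"
  shows "r dvd t"
proof -
  obtain x y where xy: "x * a + y * b = 1" using bezout_int[of a b] assms(1) by auto
  have "r dvd x * (a * t) + y * (b * t)" by (rule dvd_add[OF dvd_mult[OF assms(2)] dvd_mult[OF assms(3)]])
  also have "x * (a * t) + y * (b * t) = (x * a + y * b) * t" by (simp add: algebra_simps)
  finally show ?thesis using xy by simp
qed

text \<open>Write \<open>q = k * d\<close> and \<open>q' = k' * d\<close> with \<open>k\<close>,
  \<open>k'\<close> coprime. Two pairs with the same determinant differ by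
  \<open>(k * t, k' * t)\<close>; both entries are divisible by \<open>r\<close>, hence so is
  \<open>t\<close>. Thus \<open>P\<close> runs through one class modulo \<open>r * k\<close> inside
  \<open>[0, r * k * d)\<close>.\<close>

lemma card_determinant_fibre_le:
  fixes a r M :: int and q q' :: nat
  assumes "r > 0" and "q > 0" and "q' > 0"
  shows "card {(P, P'). P \<in> centres a r Y q \<and> P' \<in> centres a r Y q' \<and> P * int q' - P' * int q = M} \<le> gcd q q'"
    (is "card ?F \<le> _")
proof -
  define d where "d = gcd q q'"
  obtain k k' where k: "q = k * d" "q' = k' * d" "coprime k k'"
    using gcd_coprime_exists[of q q'] assms(2) unfolding d_def by auto
  have pos: "k > 0" "k' > 0" "d > 0" using assms k by (auto intro!: gr0I)
  have inj: "inj_on fst ?F" using assms by (auto simp: inj_on_def)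
  have "card (fst ` ?F) \<le> d"
  proof (rule card_residue_class_le[of "r * int k"])
    show "r * int k > 0" using assms pos by simp
    show "fst ` ?F \<subseteq> {0..<r * int k * int d}" using k(1) by (auto simp: centres_def)
    fix x y assume "x \<in> fst ` ?F" "y \<in> fst ` ?F"
    then obtain x' y' where *: "[x = a] (mod r)" "[x' = a] (mod r)" "[y = a] (mod r)" "[y' = a] (mod r)"
      "x * int q' - x' * int q = M" "y * int q' - y' * int q = M"
      by (auto simp: centres_def)
    have r: "r dvd x - y" "r dvd x' - y'"
      using * by (meson cong_iff_dvd_diff cong_sym cong_trans)+
    have "(x - y) * int k' * int d = (x' - y') * int k * int d"
      using *(5,6) k by (simp add: algebra_simps)
    then have eq: "(x - y) * int k' = (x' - y') * int k" using pos by simp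
    then have "int k dvd (x - y) * int k'" by simp
    then have "int k dvd x - y" using k(3) by (simp add: coprime_dvd_mult_left_iff)
    then obtain t where t: "x - y = int k * t" by (elim dvdE)
    with eq pos have t': "x' - y' = int k' * t" by (simp add: mult.commute)
    have "r dvd t"
      by (rule dvd_of_dvd_coprime_multiples[of "int k" "int k'"]) (use k r t t' in auto)
    then show "[x = y] (mod r * int k)"
      unfolding cong_iff_dvd_diff t by (auto simp: mult.commute)
  qed
  then show ?thesis using card_image[OF inj] by (simp add: d_def)
qed

section \<open>Pairs of nearby or coinciding centres\<close>

lemma card_int_closed_interval_le:
  assumes "x \<le> y"
  shows "finite {t::int. x \<le> real_of_int t \<and> real_of_int t \<le> y}"
    and "real (card {t::int. x \<le> real_of_int t \<and> real_of_int t \<le> y}) \<le> y - x + 1"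
proof -
  have eq: "{t::int. x \<le> real_of_int t \<and> real_of_int t \<le> y} = {\<lceil>x\<rceil>..\<lfloor>y\<rfloor>}"
    by (auto simp: ceiling_le_iff le_floor_iff)
  show "finite {t::int. x \<le> real_of_int t \<and> real_of_int t \<le> y}" unfolding eq by simp
  have "\<lceil>x\<rceil> \<le> \<lfloor>y\<rfloor> + 1" using assms by linarith
  then have "real (card {\<lceil>x\<rceil>..\<lfloor>y\<rfloor>}) = of_int \<lfloor>y\<rfloor> + 1 - of_int \<lceil>x\<rceil>" by simp
  then show "real (card {t::int. x \<le> real_of_int t \<and> real_of_int t \<le> y}) \<le> y - x + 1"
    unfolding eq by linarith
qed

text \<open>With \<open>d = gcd q q'\<close>, the determinant \<open>P * q' - P' * q\<close> is
  bounded by \<open>r * D * d\<close> and equals \<open>d * (u + r * t)\<close> with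
  \<open>u\<close> fixed. So \<open>t\<close> lies in an interval of length \<open>2 * D\<close>,
  and each determinant value comes from at most \<open>d\<close> pairs. A nonzero determinant is at
  least \<open>d\<close> in absolute value, which is impossible when
  \<open>r * D < 1\<close>.\<close>

lemma close_pairs:
  fixes a r :: int and q q' :: nat and \<eta> Y D :: real
  assumes r: "r > 0" and q: "q > 0" "q' > 0" and \<eta>: "\<eta> \<ge> 0"
  defines "Pr \<equiv> {(P, P'). P \<in> centres a r Y q \<and> P' \<in> centres a r Y q' \<and> P * int q' \<noteq> P' * int q
    \<and> \<bar>P / (r * q) - P' / (r * q')\<bar> \<le> \<eta>}"
  defines "D \<equiv> real (lcm q q') * \<eta>"
  shows "finite Pr" and "real (card Pr) \<le> real (gcd q q') * (2 * D + 1)" and "r * D < 1 \<Longrightarrow> Pr = {}"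
proof -
  define d where "d = gcd q q'"
  obtain k k' where k: "q = k * d" "q' = k' * d" "coprime k k'"
    using gcd_coprime_exists[of q q'] q unfolding d_def by auto
  have pos: "k > 0" "k' > 0" "d > 0" using q k by (auto intro!: gr0I)
  have lcm: "d * lcm q q' = q * q'" unfolding d_def by (rule prod_gcd_lcm_nat[symmetric])
  show fin: "finite Pr"
    by (rule finite_subset[of _ "centres a r Y q \<times> centres a r Y q'"]) (auto simp: Pr_def)
  let ?m = "\<lambda>(P, P'). P * int q' - P' * int q"
  have m_le: "real_of_int \<bar>?m (P, P')\<bar> \<le> r * D * d" if "(P, P') \<in> Pr" for P P'
  proof -
    have "P / (r * q) - P' / (r * q') = real_of_int (?m (P, P')) / (r * q * q')"
      using r q by (simp add: field_simps)
    then have "\<bar>real_of_int (?m (P, P'))\<bar> / (r * q * q') \<le> \<eta>"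
      using that r q by (simp add: Pr_def abs_mult)
    then have "\<bar>real_of_int (?m (P, P'))\<bar> \<le> \<eta> * (r * (real q * real q'))"
      using r q by (simp add: field_simps)
    moreover have "real q * real q' = real d * real (lcm q q')" using lcm by (metis of_nat_mult)
    ultimately show ?thesis by (simp add: D_def algebra_simps)
  qed
  have m_form: "\<exists>t. ?m (P, P') = int d * (a * (int k' - int k) + r * t)" if "(P, P') \<in> Pr" for P P'
  proof -
    have "[P = a] (mod r)" "[P' = a] (mod r)" using that by (auto simp: Pr_def centres_def)
    then obtain s s' where "P = a + r * s" "P' = a + r * s'"
      by (metis add.commute cong_iff_lin cong_sym mult.commute)
    then show ?thesis using k by (intro exI[of _ "s * int k' - s' * int k"]) (simp add: algebra_simps)
  qed
  define u where "u = a * (int k' - int k)"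
  let ?T = "{t::int. - D - u / r \<le> real_of_int t \<and> real_of_int t \<le> D - u / r}"
  have D0: "D \<ge> 0" using \<eta> by (simp add: D_def)
  then have T: "finite ?T" "real (card ?T) \<le> 2 * D + 1"
    using card_int_closed_interval_le[of "- D - u / r" "D - u / r"] by auto
  have img: "?m ` Pr \<subseteq> (\<lambda>t. int d * (u + r * t)) ` ?T"
  proof safe
    fix P P' assume PP: "(P, P') \<in> Pr"
    obtain t where t: "?m (P, P') = int d * (u + r * t)" using m_form[OF PP] unfolding u_def by blast
    have "d * \<bar>real_of_int (u + r * t)\<bar> \<le> d * (r * D)"
      using m_le[OF PP] unfolding t abs_mult of_int_mult of_int_abs by (simp add: mult_ac)
    then have "\<bar>real_of_int (u + r * t)\<bar> \<le> r * D" using pos by simp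
    then have "t \<in> ?T" using r by (simp add: field_simps abs_le_iff)
    then show "P * int q' - P' * int q \<in> (\<lambda>t. int d * (u + r * t)) ` ?T" using t by auto
  qed
  have "card Pr \<le> (\<Sum>M\<in>?m ` Pr. card {x \<in> Pr. ?m x = M})"
    using fin by (subst card_eq_sum) (subst sum.image_gen[where g = ?m], auto)
  also have "\<dots> \<le> (\<Sum>M\<in>?m ` Pr. d)"
  proof (rule sum_mono)
    fix M assume "M \<in> ?m ` Pr"
    have "card {x \<in> Pr. ?m x = M} \<le> card {(P, P'). P \<in> centres a r Y q \<and> P' \<in> centres a r Y q' \<and> P * int q' - P' * int q = M}"
      by (rule card_mono[OF finite_subset[of _ "centres a r Y q \<times> centres a r Y q'"]]) (auto simp: Pr_def)
    also have "\<dots> \<le> d" unfolding d_def using r q by (rule card_determinant_fibre_le)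
    finally show "card {x \<in> Pr. ?m x = M} \<le> d" .
  qed
  also have "\<dots> = d * card (?m ` Pr)" by simp
  also have "\<dots> \<le> d * card ?T"
    using surj_card_le[OF T(1) img] by simp
  finally have "real (card Pr) \<le> real d * real (card ?T)" by (metis of_nat_le_iff of_nat_mult)
  also have "\<dots> \<le> real d * (2 * D + 1)" using T by (intro mult_left_mono) auto
  finally show "real (card Pr) \<le> real (gcd q q') * (2 * D + 1)" by (simp add: d_def)
  show "Pr = {}" if "r * D < 1"
  proof (rule ccontr)
    assume "Pr \<noteq> {}"
    then obtain P P' where PP: "(P, P') \<in> Pr" by auto
    then have "?m (P, P') \<noteq> 0" by (auto simp: Pr_def)
    moreover have "int d dvd ?m (P, P')" using m_form[OF PP] by auto
    ultimately have "\<bar>int d\<bar> \<le> \<bar>?m (P, P')\<bar>" by (rule dvd_imp_le_int)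
    then have "real_of_int (int d) \<le> real_of_int \<bar>?m (P, P')\<bar>" unfolding of_int_le_iff by simp
    then have "real d \<le> real_of_int \<bar>?m (P, P')\<bar>" by simp
    also have "\<dots> \<le> r * D * d" by (rule m_le[OF PP])
    finally show False using that pos by simp
  qed
qed

text \<open>All fractions \<open>P' / q'\<close> counted here have the same value, so each pair is
  determined by its gcd, a positive integer not exceeding \<open>Y\<close>.\<close>

lemma card_equal_centres_le:
  fixes q :: nat and P :: int
  assumes "Y \<ge> 0" and "q > 0" and "\<And>q'. q' \<in> B \<Longrightarrow> q' > 0"
  shows "real (card {(q', P'). q' \<in> B \<and> P' \<in> centres a r Y q' \<and> P * int q' = P' * int q}) \<le> Y"
    (is "real (card ?Z) \<le> _")
proof -
  let ?g = "\<lambda>(q', P'). gcd P' (int q')"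
  have "inj_on ?g ?Z"
  proof (rule inj_onI, clarify)
    fix q1 q2 :: nat and P1 P2 :: int
    assume 1: "q1 \<in> B" "P * int q1 = P1 * int q" and 2: "q2 \<in> B" "P * int q2 = P2 * int q"
      and g: "gcd P1 (int q1) = gcd P2 (int q2)"
    define g where "g = gcd P1 (int q1)"
    have "q1 > 0" "q2 > 0" using 1 2 assms by auto
    then have g0: "g > 0" by (simp add: g_def)
    obtain u1 v1 where uv1: "P1 = u1 * g" "int q1 = v1 * g" "coprime u1 v1"
      using gcd_coprime_exists[of P1 "int q1"] g0 unfolding g_def by auto
    obtain u2 v2 where uv2: "P2 = u2 * g" "int q2 = v2 * g" "coprime u2 v2"
      using gcd_coprime_exists[of P2 "int q2"] g0 unfolding g_def g by auto
    have v: "v1 > 0" "v2 > 0"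
      using uv1(2) uv2(2) \<open>q1 > 0\<close> \<open>q2 > 0\<close> g0 by (metis of_nat_0_less_iff zero_less_mult_pos2)+
    have "(P1 * int q2) * int q = (P2 * int q1) * int q" using 1 2 by (metis mult.assoc mult.commute)
    then have "P1 * int q2 = P2 * int q1" using assms(2) by simp
    then have "u1 * v2 * (g * g) = u2 * v1 * (g * g)" unfolding uv1 uv2 by (simp add: algebra_simps)
    then have eq: "u1 * v2 = u2 * v1" using g0 by simp
    have "v1 dvd u1 * v2" "v2 dvd u2 * v1" using eq by (simp, metis dvd_triv_right)
    then have "v1 dvd v2" "v2 dvd v1"
      using uv1(3) uv2(3) by (auto simp: coprime_commute coprime_dvd_mult_right_iff)
    then have "v1 = v2" using v by (simp add: zdvd_antisym_nonneg)
    with eq v have "u1 = u2" by simp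
    with \<open>v1 = v2\<close> uv1 uv2 show "q1 = q2 \<and> P1 = P2" by simp
  qed
  moreover have "?g ` ?Z \<subseteq> {1..\<lfloor>Y\<rfloor>}"
  proof safe
    fix q' P' assume "q' \<in> B" "P' \<in> centres a r Y q'"
    then have g: "gcd P' (int q') > 0" "real_of_int (gcd P' (int q')) \<le> Y"
      using assms(3) by (auto simp: centres_def)
    from g(1) have "1 \<le> gcd P' (int q')" by linarith
    with g(2) show "gcd P' (int q') \<in> {1..\<lfloor>Y\<rfloor>}" unfolding atLeastAtMost_iff le_floor_iff by blast
  qed
  ultimately have "card ?Z \<le> card {1..\<lfloor>Y\<rfloor>}" by (intro card_inj_on_le) auto
  then show ?thesis using assms(1) by simp linarith
qed

section \<open>Bounding the total measure of the overlaps\<close>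

lemma measure_Icc_Int_le:
  fixes c c' d d' :: real
  assumes "d \<ge> 0" and "d' \<ge> 0"
  shows "measure lborel ({c..c + d} \<inter> {c'..c' + d'}) \<le> (if \<bar>c - c'\<bar> \<le> max d d' then min d d' else 0)"
proof -
  have eq: "{c..c + d} \<inter> {c'..c' + d'} = {max c c'..min (c + d) (c' + d')}" by auto
  show ?thesis
  proof (cases "max c c' \<le> min (c + d) (c' + d')")
    case True
    then have "measure lborel ({c..c + d} \<inter> {c'..c' + d'}) = min (c + d) (c' + d') - max c c'"
      unfolding eq by simp
    with True assms show ?thesis by (auto simp: max_def min_def split: if_splits)
  next
    case False
    then have "{c..c + d} \<inter> {c'..c' + d'} = {}" unfolding eq by auto
    with assms show ?thesis by simp
  qed
qed

text \<open>Pairs with equal centres contribute at most \<open>Y * S\<close>. For distinct centres,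
  put \<open>w = (q * \<delta> q) * (q' * \<delta> q')\<close>; the count
  \<open>gcd * (2 * D + 1)\<close> times the shorter length is \<open>2 * w\<close> plus a
  remainder. The remainder is at most \<open>w\<close> if \<open>D \<ge> 1\<close>, at most
  \<open>r * w\<close> if \<open>1 \<le> r * D\<close> and \<open>D < 1\<close>, and no close pair
  exists if \<open>r * D < 1\<close>.\<close>

lemma sum_overlaps_le:
  fixes a r :: int and Y S :: real and \<delta> :: "nat \<Rightarrow> real" and B :: "nat set" and D :: "nat \<Rightarrow> nat \<Rightarrow> real"
  assumes r: "r > 0" and Y: "Y \<ge> 0" and B: "finite B" "\<And>q. q \<in> B \<Longrightarrow> q > 0" "\<And>q. q \<in> B \<Longrightarrow> \<delta> q > 0"
  defines "I \<equiv> \<lambda>(q, P). {real_of_int P / (r * q)..real_of_int P / (r * q) + \<delta> q}"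
  defines "X \<equiv> Sigma B (centres a r Y)"
  defines "D \<equiv> \<lambda>q q'. real (lcm q q') * max (\<delta> q) (\<delta> q')"
  defines "S \<equiv> \<Sum>q\<in>B. q * \<delta> q"
  shows "(\<Sum>i\<in>X. \<Sum>j\<in>X. measure lborel (I i \<inter> I j))
    \<le> 3 * S\<^sup>2 + r * (\<Sum>(q, q') | (q, q') \<in> B \<times> B \<and> 1 \<le> r * D q q' \<and> D q q' < 1. (q * \<delta> q) * (q' * \<delta> q')) + Y * S"
proof -
  let ?eq = "\<lambda>q P q' P'. P * int q' = P' * int q"
  let ?close = "\<lambda>q P q' P'. P * int q' \<noteq> P' * int q
    \<and> \<bar>real_of_int P / (r * q) - P' / (r * q')\<bar> \<le> max (\<delta> q) (\<delta> q')"
  let ?C = "centres a r Y"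
  let ?bad = "{(q, q'). (q, q') \<in> B \<times> B \<and> 1 \<le> r * D q q' \<and> D q q' < 1}"
  define m where "m = (\<lambda>q q'. min (\<delta> q) (\<delta> q'))"
  have finX: "finite X" using B by (simp add: X_def)
  have m0: "0 \<le> m q q'" "m q q' \<le> \<delta> q" if "q \<in> B" "q' \<in> B" for q q'
    using B(3) that by (auto simp: m_def intro: less_imp_le)
  have le: "measure lborel (I (q, P) \<inter> I (q', P')) \<le>
     (if ?eq q P q' P' then m q q' else 0) + (if ?close q P q' P' then m q q' else 0)"
    if "q \<in> B" "q' \<in> B" for q P q' P'
    using measure_Icc_Int_le[of "\<delta> q" "\<delta> q'" "real_of_int P / (r * q)" "real_of_int P' / (r * q')"]
      B(3)[OF that(1)] B(3)[OF that(2)] m0[OF that] unfolding I_def m_def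
    by (auto split: if_splits)

  have diag: "(\<Sum>(q, P)\<in>X. \<Sum>(q', P')\<in>X. if ?eq q P q' P' then m q q' else 0) \<le> Y * S"
  proof -
    have "(\<Sum>(q, P)\<in>X. \<Sum>(q', P')\<in>X. if ?eq q P q' P' then m q q' else 0) \<le> (\<Sum>(q, P)\<in>X. \<delta> q * Y)"
    proof (rule sum_mono, clarify)
      fix q P assume qP: "(q, P) \<in> X"
      then have q: "q \<in> B" by (simp add: X_def)
      let ?Z = "{(q', P'). q' \<in> B \<and> P' \<in> ?C q' \<and> ?eq q P q' P'}"
      have Z: "?Z \<subseteq> X" by (auto simp: X_def)
      have "(\<Sum>(q', P')\<in>X. if ?eq q P q' P' then m q q' else 0) \<le> (\<Sum>(q', P')\<in>X. if ?eq q P q' P' then \<delta> q else 0)"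
        using m0(2)[OF q] by (intro sum_mono) (auto simp: X_def)
      also have "\<dots> = (\<Sum>(q', P')\<in>?Z. \<delta> q)"
        by (rule sum.mono_neutral_cong_right[OF finX Z]) (auto simp: X_def split: if_splits)
      also have "\<dots> = \<delta> q * real (card ?Z)" by (simp add: case_prod_unfold)
      also have "\<dots> \<le> \<delta> q * Y"
        using card_equal_centres_le[OF Y, where q = q and B = B and P = P and a = a and r = r] B(2,3) q by (intro mult_left_mono) (auto intro: less_imp_le)
      finally show "(\<Sum>(q', P')\<in>X. if ?eq q P q' P' then m q q' else 0) \<le> \<delta> q * Y" .
    qed
    also have "\<dots> = (\<Sum>q\<in>B. \<Sum>P\<in>?C q. \<delta> q * Y)"
      unfolding X_def using B by (subst sum.Sigma) auto
    also have "\<dots> = (\<Sum>q\<in>B. real (card (?C q)) * (\<delta> q * Y))" by simp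
    also have "\<dots> \<le> (\<Sum>q\<in>B. real q * (\<delta> q * Y))"
      using card_centres_le[OF r] Y by (intro sum_mono mult_right_mono) (auto simp: B(3)[THEN less_imp_le])
    also have "\<dots> = Y * S" by (simp add: S_def sum_distrib_left algebra_simps)
    finally show ?thesis .
  qed

  have pair: "(\<Sum>P\<in>?C q. \<Sum>P'\<in>?C q'. if ?close q P q' P' then m q q' else 0)
     \<le> 3 * ((q * \<delta> q) * (q' * \<delta> q')) + (if (q, q') \<in> ?bad then r * ((q * \<delta> q) * (q' * \<delta> q')) else 0)"
    if q: "q \<in> B" "q' \<in> B" for q q'
  proof -
    let ?Pr = "{(P, P'). P \<in> ?C q \<and> P' \<in> ?C q' \<and> P * int q' \<noteq> P' * int q
      \<and> \<bar>real_of_int P / (r * q) - P' / (r * q')\<bar> \<le> max (\<delta> q) (\<delta> q')}"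
    let ?w = "(q * \<delta> q) * (q' * \<delta> q')"
    have pos: "q > 0" "q' > 0" "\<delta> q > 0" "\<delta> q' > 0" using B q by auto
    have eta: "max (\<delta> q) (\<delta> q') \<ge> 0" using pos by simp
    note cp = close_pairs[OF r pos(1,2) eta, where a = a and Y = Y]
    have D0: "D q q' > 0" using pos by (simp add: D_def lcm_pos_nat less_max_iff_disj)
    \<comment> \<open>Combines \<open>gcd * lcm = q * q'\<close> with
      \<open>min * max = \<delta> q * \<delta> q'\<close>.\<close>
    have w: "real (gcd q q') * m q q' * D q q' = ?w"
    proof -
      have "real (gcd q q') * real (lcm q q') = real q * real q'"
        by (metis of_nat_mult prod_gcd_lcm_nat)
      moreover have "m q q' * max (\<delta> q) (\<delta> q') = \<delta> q * \<delta> q'" by (simp add: m_def min_def max_def)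
      ultimately show ?thesis by (simp add: D_def algebra_simps) (metis mult.assoc mult.commute)
    qed
    have "(\<Sum>P\<in>?C q. \<Sum>P'\<in>?C q'. if ?close q P q' P' then m q q' else 0)
      = (\<Sum>(P, P')\<in>?C q \<times> ?C q'. if ?close q P q' P' then m q q' else 0)"
      by (rule sum.cartesian_product)
    also have "\<dots> = (\<Sum>(P, P')\<in>?Pr. m q q')"
      by (rule sum.mono_neutral_cong_right) (auto split: if_splits)
    also have "\<dots> = real (card ?Pr) * m q q'" by (simp add: case_prod_unfold)
    also have "\<dots> \<le> 3 * ?w + (if (q, q') \<in> ?bad then r * ?w else 0)"
    proof (cases "r * D q q' < 1")
      case True
      then have "?Pr = {}" using cp(3) by (simp add: D_def)
      then have "card ?Pr = 0" by (simp only: card.empty)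
      then have "real (card ?Pr) * m q q' = 0" by (simp only: of_nat_0 mult_zero_left)
      also have "\<dots> \<le> 3 * ?w + (if (q, q') \<in> ?bad then r * ?w else 0)" using pos r by simp
      finally show ?thesis .
    next
      case False
      have "real (card ?Pr) * m q q' \<le> real (gcd q q') * (2 * D q q' + 1) * m q q'"
        using cp(2) m0[OF q] unfolding D_def by (intro mult_right_mono) auto
      also have "\<dots> = 2 * ?w + real (gcd q q') * m q q'" unfolding w[symmetric] by (simp add: algebra_simps)
      also have "\<dots> \<le> 2 * ?w + (?w + (if (q, q') \<in> ?bad then r * ?w else 0))"
      proof (intro add_left_mono)
        let ?v = "real (gcd q q') * m q q'"
        have v: "?v \<ge> 0" using m0[OF q] by simp
        show "?v \<le> ?w + (if (q, q') \<in> ?bad then r * ?w else 0)"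
        proof (cases "D q q' < 1")
          case True
          have "?v \<le> ?v * (r * D q q')" using False v mult_left_mono[of 1 "r * D q q'" ?v] by simp
          also have "\<dots> = r * ?w" unfolding w[symmetric] by simp
          finally have "?v \<le> r * ?w" .
          moreover have "(if (q, q') \<in> ?bad then r * ?w else 0) = r * ?w" using True False q by simp
          moreover have "0 \<le> ?w" using pos by simp
          ultimately show ?thesis by linarith
        next
          case False
          have "?v \<le> ?v * D q q'" using False v mult_left_mono[of 1 "D q q'" ?v] by simp
          then show ?thesis using False w by simp
        qed
      qed
      finally show ?thesis by linarith
    qed
    finally show ?thesis .
  qed

  have "(\<Sum>i\<in>X. \<Sum>j\<in>X. measure lborel (I i \<inter> I j)) \<le> (\<Sum>(q, P)\<in>X. \<Sum>(q', P')\<in>X.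
     (if ?eq q P q' P' then m q q' else 0) + (if ?close q P q' P' then m q q' else 0))"
    using le by (intro sum_mono) (auto simp: X_def intro!: sum_mono)
  also have "\<dots> = (\<Sum>(q, P)\<in>X. \<Sum>(q', P')\<in>X. if ?eq q P q' P' then m q q' else 0)
     + (\<Sum>(q, P)\<in>X. \<Sum>(q', P')\<in>X. if ?close q P q' P' then m q q' else 0)"
    by (simp add: case_prod_unfold sum.distrib)
  also have "(\<Sum>(q, P)\<in>X. \<Sum>(q', P')\<in>X. if ?close q P q' P' then m q q' else 0)
     = (\<Sum>q\<in>B. \<Sum>P\<in>?C q. \<Sum>q'\<in>B. \<Sum>P'\<in>?C q'. if ?close q P q' P' then m q q' else 0)"
    unfolding X_def using B(1) by (simp add: sum.Sigma[symmetric] finite_SigmaI)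
  also have "\<dots> = (\<Sum>q\<in>B. \<Sum>q'\<in>B. \<Sum>P\<in>?C q. \<Sum>P'\<in>?C q'. if ?close q P q' P' then m q q' else 0)"
    by (intro sum.cong refl sum.swap)
  also have "\<dots> \<le> (\<Sum>q\<in>B. \<Sum>q'\<in>B. 3 * ((q * \<delta> q) * (q' * \<delta> q'))
     + (if (q, q') \<in> ?bad then r * ((q * \<delta> q) * (q' * \<delta> q')) else 0))"
    by (intro sum_mono pair)
  also have "\<dots> = 3 * (\<Sum>q\<in>B. \<Sum>q'\<in>B. (q * \<delta> q) * (q' * \<delta> q'))
     + (\<Sum>q\<in>B. \<Sum>q'\<in>B. if (q, q') \<in> ?bad then r * ((q * \<delta> q) * (q' * \<delta> q')) else 0)"
    by (simp only: sum.distrib sum_distrib_left)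
  also have "(\<Sum>q\<in>B. \<Sum>q'\<in>B. (q * \<delta> q) * (q' * \<delta> q')) = S\<^sup>2"
    by (simp add: S_def power2_eq_square sum_product)
  also have "(\<Sum>q\<in>B. \<Sum>q'\<in>B. if (q, q') \<in> ?bad then r * ((q * \<delta> q) * (q' * \<delta> q')) else 0)
     = (\<Sum>(q, q')\<in>B \<times> B. if (q, q') \<in> ?bad then r * ((q * \<delta> q) * (q' * \<delta> q')) else 0)"
    by (rule sum.cartesian_product)
  also have "\<dots> = (\<Sum>(q, q')\<in>?bad. r * ((q * \<delta> q) * (q' * \<delta> q')))"
    using B(1) by (intro sum.mono_neutral_cong_right) (auto split: if_splits)
  also have "\<dots> = r * (\<Sum>(q, q')\<in>?bad. (q * \<delta> q) * (q' * \<delta> q'))"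
    by (simp add: sum_distrib_left case_prod_unfold)
  finally show ?thesis using diag by linarith
qed

text \<open>The intervals \<open>[\<theta>/r, \<theta>)\<close> are disjoint for \<open>\<theta> = 2r, 2r\<^sup>2, \<dots>\<close>, so that one of the first
  \<open>r\<close> of these scales makes the pairs that lose a factor \<open>r\<close> carry at most \<open>1/r\<close> of the total weight.\<close>
lemma exists_scale_sum_overlaps_le:
  fixes a r :: int and Y S :: real and \<psi> :: "nat \<Rightarrow> real" and B :: "nat set"
  assumes r: "r \<ge> 2" and Y: "Y \<ge> 0" and B: "finite B" "\<And>q. q \<in> B \<Longrightarrow> q > 0" "\<And>q. q \<in> B \<Longrightarrow> \<psi> q > 0"
  defines "S \<equiv> sum \<psi> B"
  defines "X \<equiv> Sigma B (centres a r Y)"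
  obtains \<theta> :: real where "2 \<le> \<theta>" and "\<theta> \<le> 2 * r ^ nat r"
    and "(\<Sum>i\<in>X. \<Sum>j\<in>X. measure lborel
      ((\<lambda>(q, P). {real_of_int P / (r * q)..real_of_int P / (r * q) + \<psi> q / (\<theta> * q)}) i
       \<inter> (\<lambda>(q, P). {real_of_int P / (r * q)..real_of_int P / (r * q) + \<psi> q / (\<theta> * q)}) j))
     \<le> 4 * (S / \<theta>)\<^sup>2 + Y * (S / \<theta>)"
proof -
  define \<Lambda> where "\<Lambda> = (\<lambda>i::nat. 2 * real_of_int r ^ i)"
  define E where "E = (\<lambda>q q'. real (lcm q q') * max (\<psi> q / q) (\<psi> q' / q'))"
  define bad where "bad = (\<lambda>i. {(q, q'). (q, q') \<in> B \<times> B \<and> \<Lambda> i \<le> r * E q q' \<and> E q q' < \<Lambda> i})"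
  have L: "\<Lambda> i > 0" "\<Lambda> (Suc i) = r * \<Lambda> i" for i using r by (auto simp: \<Lambda>_def)
  have L_le: "r * \<Lambda> i \<le> \<Lambda> j" if "i < j" for i j
  proof -
    have "real_of_int r ^ Suc i \<le> real_of_int r ^ j" using that r by (intro power_increasing) auto
    then show ?thesis by (simp add: \<Lambda>_def)
  qed
  let ?n = "nat r"
  have disj: "bad i \<inter> bad j = {}" if "i < j" for i j
  proof (rule equals0I, clarify)
    fix q q' assume "(q, q') \<in> bad i" "(q, q') \<in> bad j"
    then have "E q q' < \<Lambda> i" "\<Lambda> j \<le> r * E q q'" by (auto simp: bad_def)
    then have "\<Lambda> j < r * \<Lambda> i" using r by (smt (verit) mult_strict_left_mono of_int_0_less_iff)
    with L_le[OF that] show False by simp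
  qed
  then have disj': "bad i \<inter> bad j = {}" if "i \<noteq> j" for i j
    using that by (metis inf.commute linorder_neqE_nat)
  have fin: "finite (bad i)" for i by (rule finite_subset[of _ "B \<times> B"]) (use B(1) in \<open>auto simp: bad_def\<close>)
  let ?w = "\<lambda>(q, q'). \<psi> q * \<psi> q'"
  have "(\<Sum>i=1..?n. sum ?w (bad i)) = sum ?w (\<Union>i\<in>{1..?n}. bad i)"
    by (rule sum.UNION_disjoint[symmetric]) (use fin disj' in auto)
  also have "\<dots> \<le> sum ?w (B \<times> B)"
    using B(1) by (intro sum_mono2) (auto simp: bad_def B(3)[THEN less_imp_le])
  also have "\<dots> = S\<^sup>2" by (simp add: S_def power2_eq_square sum_product sum.cartesian_product)
  finally have tot: "(\<Sum>i=1..?n. sum ?w (bad i)) \<le> S\<^sup>2" .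
  have "\<exists>i\<in>{1..?n}. r * sum ?w (bad i) \<le> S\<^sup>2"
  proof (rule ccontr)
    assume "\<not> (\<exists>i\<in>{1..?n}. r * sum ?w (bad i) \<le> S\<^sup>2)"
    then have "S\<^sup>2 / r < sum ?w (bad i)" if "i \<in> {1..?n}" for i
      using that r by (auto simp: not_le pos_divide_less_eq mult.commute)
    then have "(\<Sum>i=1..?n. S\<^sup>2 / r) < (\<Sum>i=1..?n. sum ?w (bad i))"
      using r by (intro sum_strict_mono) auto
    also have "(\<Sum>i=1..?n. S\<^sup>2 / r) = S\<^sup>2" using r by simp
    finally show False using tot by simp
  qed
  then obtain i where i: "i \<in> {1..?n}" "r * sum ?w (bad i) \<le> S\<^sup>2" by blast
  define \<theta> where "\<theta> = \<Lambda> i"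
  have \<theta>: "\<theta> > 0" using L by (simp add: \<theta>_def)
  have lam2: "2 \<le> \<theta>" "\<theta> \<le> 2 * r ^ ?n"
  proof -
    have "real_of_int r ^ i \<le> real_of_int r ^ ?n" using i r by (intro power_increasing) auto
    then show "\<theta> \<le> 2 * r ^ ?n" by (simp add: \<theta>_def \<Lambda>_def)
    show "2 \<le> \<theta>" using r by (simp add: \<theta>_def \<Lambda>_def)
  qed
  define \<delta> where "\<delta> = (\<lambda>q::nat. \<psi> q / (\<theta> * q))"
  have \<delta>: "q * \<delta> q = \<psi> q / \<theta>" if "q \<in> B" for q using B(2)[OF that] by (simp add: \<delta>_def)
  \<comment> \<open>Passing from \<open>\<psi> q / q\<close> to \<open>\<delta> q\<close> divides by
    \<open>\<theta>\<close>, so the critical range of \<open>sum_overlaps_le\<close> turns into the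
    range defining \<open>bad i\<close>.\<close>
  have D: "real (lcm q q') * max (\<delta> q) (\<delta> q') = E q q' / \<theta>" for q q'
  proof -
    have "max (\<delta> q) (\<delta> q') = max (\<psi> q / q) (\<psi> q' / q') / \<theta>"
      unfolding \<delta>_def using \<theta> by (simp add: max_divide_distrib_right mult.commute)
    then show ?thesis by (simp add: E_def)
  qed
  have bad: "{(q, q'). (q, q') \<in> B \<times> B \<and> 1 \<le> r * (real (lcm q q') * max (\<delta> q) (\<delta> q')) \<and> real (lcm q q') * max (\<delta> q) (\<delta> q') < 1} = bad i"
    unfolding D bad_def \<theta>_def[symmetric] using \<theta> by (auto simp: field_simps)
  have "(\<Sum>(q, q')\<in>bad i. (q * \<delta> q) * (q' * \<delta> q')) = (\<Sum>(q, q')\<in>bad i. (\<psi> q * \<psi> q') / \<theta>\<^sup>2)"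
    by (intro sum.cong refl) (auto simp: bad_def \<delta> power2_eq_square)
  also have "\<dots> = sum ?w (bad i) / \<theta>\<^sup>2" by (simp add: sum_divide_distrib case_prod_unfold)
  finally have w: "(\<Sum>(q, q')\<in>bad i. (q * \<delta> q) * (q' * \<delta> q')) = sum ?w (bad i) / \<theta>\<^sup>2" .
  have S: "(\<Sum>q\<in>B. q * \<delta> q) = S / \<theta>" unfolding S_def sum_divide_distrib by (intro sum.cong refl \<delta>)
  have pos: "\<delta> q > 0" if "q \<in> B" for q using B(2,3)[OF that] \<theta> by (simp add: \<delta>_def)
  have "r * (sum ?w (bad i) / \<theta>\<^sup>2) \<le> (S / \<theta>)\<^sup>2"
    using i(2) \<theta> by (simp add: power_divide divide_right_mono)
  moreover have "(\<Sum>i\<in>X. \<Sum>j\<in>X. measure lborel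
      ((\<lambda>(q, P). {real_of_int P / (r * q)..real_of_int P / (r * q) + \<delta> q}) i
       \<inter> (\<lambda>(q, P). {real_of_int P / (r * q)..real_of_int P / (r * q) + \<delta> q}) j))
    \<le> 3 * (S / \<theta>)\<^sup>2 + r * (sum ?w (bad i) / \<theta>\<^sup>2) + Y * (S / \<theta>)"
    using sum_overlaps_le[of r Y B \<delta> a] r Y B pos unfolding bad S w X_def by simp
  ultimately show ?thesis using that[OF lam2] unfolding \<delta>_def by linarith
qed

section \<open>From second moments to full measure\<close>

lemma fmeasurable_Icc: "{a..b::real} \<in> fmeasurable lborel"
  by (intro fmeasurable_compact compact_Icc)

text \<open>Only centres in the left half of the cell are counted, so that intervals of length at
  most \<open>1 / (2 * N)\<close> remain inside the cell. With \<open>P = a + r * t\<close> they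
  correspond to \<open>t\<close> in an interval of length \<open>q / (2 * N)\<close>. The sieve
  retains half of \<open>exp (- 144)\<close> times this length, and \<open>large\<close> lets the
  error consume half of that.\<close>

lemma sum_measure_cell_ge:
  fixes a r :: int and q N k :: nat and h \<delta> :: real
  assumes h: "h \<ge> 1" "exp (32 * h) \<le> ln (real q)" "ln (real q) < 4 * exp (32 * h)"
    and r: "r > 0" "coprime a r" and N: "k < N" and \<delta>: "0 \<le> \<delta>" "\<delta> \<le> 1 / (2 * N)"
    and large: "4 * sqrt (real q) * (1 + ln (real q)) \<le> real q / (2 * N) * exp (- 144) / 4"
  shows "exp (- 144) / 8 * (q * \<delta>) / N \<le> (\<Sum>P\<in>centres a r (exp (8 * h)) q.
    measure lborel ({real_of_int P / (r * q)..real_of_int P / (r * q) + \<delta>} \<inter> {real k / N..<(real k + 1) / N}))"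
proof -
  have q: "q > 0" using h(2) exp_gt_zero[of "32 * h"] by (cases "q = 0") auto
  let ?C = "centres a r (exp (8 * h)) q"
  define x where "x = real k / N * q - a / r"
  define y where "y = x + q / (2 * N)"
  let ?T = "{t::int. x \<le> real_of_int t \<and> real_of_int t < y \<and> real_of_int (gcd (a + r * t) (int q)) \<le> exp (8 * h)}"
  let ?G = "{P \<in> ?C. real k / N \<le> P / (r * q) \<and> P / (r * q) < real k / N + 1 / (2 * N)}"
  have "x \<le> y" by (simp add: y_def)
  from card_small_gcd_ge[OF h r(2) this] large
  have T: "real q / (2 * N) * exp (- 144) / 4 \<le> real (card ?T)" by (simp add: y_def)
  have "(\<lambda>t. a + r * t) ` ?T \<subseteq> ?G"
  proof safe
    fix t :: int
    assume t: "x \<le> real_of_int t" "real_of_int t < y" "real_of_int (gcd (a + r * t) (int q)) \<le> exp (8 * h)"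
    have eq: "real_of_int (a + r * t) / (r * q) = (t + a / r) / q" using r q by (simp add: field_simps)
    show 1: "real k / N \<le> (a + r * t) / (r * q)"
      unfolding eq using t(1) q by (simp add: x_def pos_le_divide_eq)
    have "real k / N * q + 1 / (2 * N) * q = (real k / N + 1 / (2 * N)) * q" by (simp add: algebra_simps)
    then show 2: "(a + r * t) / (r * q) < real k / N + 1 / (2 * N)"
      unfolding eq using t(2) q by (simp add: x_def y_def pos_divide_less_eq)
    \<comment> \<open>As \<open>k < N\<close>, the cell lies in [0, 1], which yields the bound
      \<open>P < r * q\<close> required by \<open>centres\<close>.\<close>
    have "real k + 1 \<le> real N" using N by linarith
    then have "real k / N + 1 / (2 * N) \<le> 1" using N by (simp add: field_simps)
    from less_le_trans[OF 2 this] have "real_of_int (a + r * t) < r * q" using r q by (simp add: divide_less_eq)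
    moreover have "0 \<le> real_of_int (a + r * t)"
      using order_trans[OF _ 1, of 0] pos_le_divide_eq[of "real_of_int (r * q)" 0] r q by simp
    ultimately have "a + r * t < r * int q" "0 \<le> a + r * t"
      by (metis of_int_less_iff of_int_mult of_int_of_nat_eq, simp only: of_int_0_le_iff)
    then show "a + r * t \<in> ?C" using t(3) by (simp add: centres_def cong_def)
  qed
  moreover have "inj_on (\<lambda>t. a + r * t) ?T" using r by (auto simp: inj_on_def)
  ultimately have "card ?T \<le> card ?G" by (intro card_inj_on_le[of "\<lambda>t. a + r * t"]) auto
  with T have G: "real q / (2 * N) * exp (- 144) / 4 \<le> real (card ?G)" by linarith
  let ?A = "\<lambda>P. {real_of_int P / (r * q)..real_of_int P / (r * q) + \<delta>} \<inter> {real k / N..<(real k + 1) / N}"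
  have A: "\<delta> \<le> measure lborel (?A P)" if P: "P \<in> ?G" for P
  proof -
    let ?c = "real_of_int P / (r * q)"
    have "real k / N + 1 / (2 * N) + 1 / (2 * N) = (real k + 1) / N" using N by (simp add: field_simps)
    \<comment> \<open>The right endpoint is dropped because the cell is half-open; the measure is
      unaffected.\<close>
    then have "{?c..<?c + \<delta>} \<subseteq> ?A P" using P \<delta> by auto
    moreover have "?A P \<in> fmeasurable lborel"
      by (rule fmeasurableI2[OF fmeasurable_Icc[of ?c "?c + \<delta>"]]) auto
    ultimately have "measure lborel {?c..<?c + \<delta>} \<le> measure lborel (?A P)"
      by (intro measure_mono_fmeasurable) auto
    then show ?thesis using \<delta> by simp
  qed
  have "exp (- 144) / 8 * (q * \<delta>) / N = real q / (2 * N) * exp (- 144) / 4 * \<delta>" by simp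
  also have "\<dots> \<le> real (card ?G) * \<delta>" using G \<delta> by (intro mult_right_mono)
  also have "\<dots> = (\<Sum>P\<in>?G. \<delta>)" by simp
  also have "\<dots> \<le> (\<Sum>P\<in>?G. measure lborel (?A P))" by (intro sum_mono A)
  also have "\<dots> \<le> (\<Sum>P\<in>?C. measure lborel (?A P))" by (intro sum_mono2) auto
  finally show ?thesis .
qed

text \<open>With \<open>F\<close> the sum of the indicators of the \<open>A i\<close>, integrate the
  pointwise inequality \<open>F * 1_E \<le> t / 2 * F\<^sup>2 + 1_E / (2 * t)\<close>. This is
  Cauchy-Schwarz with a free parameter \<open>t\<close>.\<close>

lemma sum_measure_Int_le:
  fixes A :: "'i \<Rightarrow> 'a set"
  assumes X: "finite X" and A: "\<And>i. i \<in> X \<Longrightarrow> A i \<in> fmeasurable M" and E: "E \<in> fmeasurable M" and t: "t > 0"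
  shows "(\<Sum>i\<in>X. measure M (A i \<inter> E)) \<le> t / 2 * (\<Sum>i\<in>X. \<Sum>j\<in>X. measure M (A i \<inter> A j)) + measure M E / (2 * t)"
proof -
  define F where "F = (\<lambda>x. \<Sum>i\<in>X. indicator (A i) x :: real)"
  have ii: "integrable M (indicator B :: 'a \<Rightarrow> real)" if "B \<in> fmeasurable M" for B
    using that by (intro integrable_real_indicator) (auto simp: fmeasurable_def)
  have int: "A i \<inter> B \<in> fmeasurable M" if "i \<in> X" "B \<in> fmeasurable M" for i B
    using A[OF that(1)] that(2) by (intro fmeasurable_Int_fmeasurable) (auto simp: fmeasurable_def)
  have mi: "(LINT x|M. indicator B x) = measure M B" if "B \<in> fmeasurable M" for B
    using that by (subst Bochner_Integration.integral_indicator) (auto simp: fmeasurable_def sets.Int_space_eq2)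
  have FE: "F x * indicator E x = (\<Sum>i\<in>X. indicator (A i \<inter> E) x)" for x
    by (simp add: F_def sum_distrib_right indicator_inter_arith)
  have FF: "(F x)\<^sup>2 = (\<Sum>i\<in>X. \<Sum>j\<in>X. indicator (A i \<inter> A j) x)" for x
    by (simp add: F_def power2_eq_square sum_product indicator_inter_arith)
  have iF: "integrable M (\<lambda>x. F x * indicator E x)" "integrable M (\<lambda>x. (F x)\<^sup>2)"
    unfolding FE FF using int A E ii by (auto intro!: Bochner_Integration.integrable_sum)
  have "(\<Sum>i\<in>X. measure M (A i \<inter> E)) = (LINT x|M. F x * indicator E x)"
    unfolding FE using int E ii mi by (subst Bochner_Integration.integral_sum) (auto intro!: sum.cong)
  also have "\<dots> \<le> (LINT x|M. t / 2 * (F x)\<^sup>2 + 1 / (2 * t) * indicator E x)"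
  proof (rule integral_mono)
    show "integrable M (\<lambda>x. t / 2 * (F x)\<^sup>2 + 1 / (2 * t) * indicator E x)"
      using iF(2) ii[OF E] by (intro Bochner_Integration.integrable_add integrable_mult_right) auto
    fix x
    have "0 \<le> (t * F x - indicator E x)\<^sup>2 / (2 * t)" using t by simp
    also have "\<dots> = t / 2 * (F x)\<^sup>2 + 1 / (2 * t) * (indicator E x)\<^sup>2 - F x * indicator E x"
      using t by (simp add: field_simps power2_eq_square)
    also have "(indicator E x :: real)\<^sup>2 = indicator E x" by (simp add: indicator_def)
    finally show "F x * indicator E x \<le> t / 2 * (F x)\<^sup>2 + 1 / (2 * t) * indicator E x" by simp
  qed (rule iF)
  also have "\<dots> = t / 2 * (LINT x|M. (F x)\<^sup>2) + 1 / (2 * t) * (LINT x|M. indicator E x)"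
    using iF(2) ii[OF E] by (subst Bochner_Integration.integral_add) auto
  also have "(LINT x|M. (F x)\<^sup>2) = (\<Sum>i\<in>X. \<Sum>j\<in>X. measure M (A i \<inter> A j))"
    unfolding FF using int A ii mi by (simp add: Bochner_Integration.integral_sum)
  also have "(LINT x|M. indicator E x) = measure M E" using E by (rule mi)
  finally show ?thesis by simp
qed

text \<open>Approximate a non-null \<open>Z\<close> by a union \<open>J\<close> of cells. The sets \<open>A i\<close> charge \<open>J\<close> proportionally
  but avoid \<open>Z\<close>, whereas the second moment bound limits how much they can charge \<open>J - Z\<close>.\<close>
lemma null_set_if_avoids_spread_families:
  fixes Z :: "real set" and c :: real
  assumes Z: "Z \<in> sets borel" "Z \<subseteq> {0..<1}" and c: "c > 0"
    and H: "\<And>N::nat. N > 0 \<Longrightarrow> \<exists>(X :: 'i set) A S. finite X \<and> S > 0 \<and> (\<forall>i\<in>X. A i \<in> fmeasurable lborel \<and> A i \<inter> Z = {})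
      \<and> (\<Sum>i\<in>X. \<Sum>j\<in>X. measure lborel (A i \<inter> A j)) \<le> 5 * S\<^sup>2
      \<and> (\<forall>k<N. c * S / N \<le> (\<Sum>i\<in>X. measure lborel (A i \<inter> {real k / N..<(real k + 1) / N})))"
  shows "Z \<in> null_sets lborel"
proof (rule ccontr)
  assume nonnull: "Z \<notin> null_sets lborel"
  let ?\<mu> = "measure lborel :: real set \<Rightarrow> real"
  have fm01: "Q \<in> fmeasurable lborel" if "Q \<in> sets borel" "Q \<subseteq> {0..1}" for Q :: "real set"
    using that by (intro fmeasurableI2[OF fmeasurable_Icc[of 0 1]]) auto
  have fmZ: "Z \<in> fmeasurable lborel" using Z by (intro fm01) auto
  define m where "m = ?\<mu> Z"
  have "emeasure lborel Z \<noteq> 0" using nonnull Z by auto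
  moreover have "emeasure lborel Z = ennreal m"
    using fmeasurableD2[OF fmZ] by (simp add: m_def emeasure_eq_ennreal_measure)
  ultimately have m0: "m > 0" by (metis ennreal_neg linorder_not_less)
  have "?\<mu> Z \<le> ?\<mu> {0..1}" using Z by (intro measure_mono_fmeasurable fmeasurable_Icc) auto
  then have m1: "m \<le> 1" by (simp add: m_def)
  \<comment> \<open>The first bound gives \<open>s\<^sup>2 \<le> m / 2\<close>, so that at least
    half of the measure of \<open>Z\<close> remains in \<open>K\<close>; the second makes the final
    estimate \<open>3 * s * S\<close> smaller than \<open>c * S * m / 2\<close>.\<close>
  define s where "s = min (m / 2) (c * m / 8)"
  have s: "s > 0" "s \<le> m / 2" "s \<le> c * m / 8" using m0 c by (auto simp: s_def)
  have "s * s \<le> m / 2 * 1" using s m1 by (intro mult_mono) auto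
  then have s2: "s\<^sup>2 \<le> m / 2" "s\<^sup>2 > 0" using s by (auto simp: power2_eq_square)
  obtain U where U: "open U" "Z \<subseteq> U" "emeasure lborel (U - Z) < ennreal (s\<^sup>2)"
    using outer_regular_lborel[OF Z(1) s2(2)] .
  \<comment> \<open>Outer regularity of the complement provides inner approximation of
    \<open>Z\<close>; the resulting closed set is compact because \<open>Z\<close> is
    bounded.\<close>
  obtain V where V: "open V" "- Z \<subseteq> V" "emeasure lborel (V - (- Z)) < ennreal (s\<^sup>2)"
    using outer_regular_lborel[of "- Z", OF _ s2(2)] Z(1) by (metis borel_comp)
  define K where "K = - V"
  have K: "compact K" "K \<subseteq> Z"
  proof -
    show "K \<subseteq> Z" using V by (auto simp: K_def)
    then have "bounded K" using Z by (intro bounded_subset[OF bounded_closed_interval[of 0 1]]) auto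
    moreover have "closed K" using V by (simp add: K_def closed_Compl)
    ultimately show "compact K" by (simp add: compact_eq_bounded_closed)
  qed
  have KZ: "m - s\<^sup>2 \<le> ?\<mu> K"
  proof -
    have "V - (- Z) = Z - K" by (auto simp: K_def)
    then have "emeasure lborel (Z - K) \<le> ennreal (s\<^sup>2)" using V(3) by simp
    then have "?\<mu> (Z - K) \<le> s\<^sup>2" by (simp add: measure_def enn2real_leI)
    moreover have "?\<mu> (Z - K) = ?\<mu> Z - ?\<mu> K"
      using K fmZ by (intro measurable_measure_Diff) (auto intro!: borel_compact)
    ultimately show ?thesis by (simp add: m_def)
  qed
  \<comment> \<open>The positive distance from \<open>K\<close> to the complement of
    \<open>U\<close> fixes the mesh: a cell of width below \<open>d\<close> that meets
    \<open>K\<close> is contained in \<open>U\<close>.\<close>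
  have "K \<inter> - U = {}" using K U by auto
  then obtain d where d: "d > 0" "\<And>x y. x \<in> K \<Longrightarrow> y \<in> - U \<Longrightarrow> d \<le> dist x y"
    using separate_compact_closed[OF K(1), of "- U"] U by (auto simp: closed_Compl)
  obtain n where n: "inverse (real (Suc n)) < d" using reals_Archimedean[OF d(1)] by blast
  define N where "N = Suc n"
  have N: "N > 0" "1 / real N < d" using n by (auto simp: N_def inverse_eq_divide)
  define cell where "cell = (\<lambda>k. {real k / N..<(real k + 1) / N})"
  define Ks where "Ks = {k. k < N \<and> cell k \<inter> K \<noteq> {}}"
  define J where "J = (\<Union>k\<in>Ks. cell k)"
  have Ks: "finite Ks" by (simp add: Ks_def)
  have cell_iff: "x \<in> cell k \<longleftrightarrow> real k \<le> x * N \<and> x * N < real k + 1" for x k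
    using N by (simp add: cell_def field_simps)
  have disj: "cell k \<inter> cell l = {}" if "k \<noteq> l" for k l
  proof (rule equals0I)
    fix x assume "x \<in> cell k \<inter> cell l"
    then have "real k < real (Suc l)" "real l < real (Suc k)" by (auto simp: cell_iff)
    then have "k < Suc l" "l < Suc k" unfolding of_nat_less_iff by auto
    with that show False by simp
  qed
  have fm_cell: "cell k \<in> fmeasurable lborel" for k
    unfolding cell_def by (rule fmeasurableI2[OF fmeasurable_Icc[of "real k / N" "(real k + 1) / N"]]) auto
  have JK: "K \<subseteq> J"
  proof
    fix x assume x: "x \<in> K"
    then have x01: "0 \<le> x" "x < 1" using K Z by auto
    define k where "k = nat \<lfloor>x * N\<rfloor>"
    have "real k = of_int \<lfloor>x * N\<rfloor>" using x01 by (simp add: k_def)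
    then have xk: "x \<in> cell k" by (simp add: cell_iff)
    have "x * N < 1 * real N" using x01 N by (intro mult_strict_right_mono) auto
    then have "real k < real N" using xk by (simp add: cell_iff)
    then have "k \<in> Ks" using x xk by (auto simp: Ks_def)
    then show "x \<in> J" using xk by (auto simp: J_def)
  qed
  have JU: "J \<subseteq> U"
  proof
    fix x assume "x \<in> J"
    then obtain k y where k: "x \<in> cell k" "y \<in> cell k" "y \<in> K" by (auto simp: J_def Ks_def)
    have "(real k + 1) / N - real k / N = 1 / N" by (simp add: add_divide_distrib)
    then have "dist y x < d" using k N by (auto simp: cell_def dist_real_def)
    then show "x \<in> U" using d(2)[OF k(3), of x] by (meson ComplI not_le)
  qed
  have fmJ: "J \<in> fmeasurable lborel" unfolding J_def using Ks
    by (intro fmeasurable.finite_UN) (auto simp: fm_cell)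
  have meas_cell: "?\<mu> (cell k) = 1 / N" for k
  proof -
    have "real k / N \<le> (real k + 1) / N" by (intro divide_right_mono) auto
    then show ?thesis by (simp add: cell_def add_divide_distrib)
  qed
  have "m / 2 \<le> m - s\<^sup>2" using s2 by simp
  also have "\<dots> \<le> ?\<mu> J" using KZ JK fmJ K(1)
    by (intro order_trans[OF KZ] measure_mono_fmeasurable) (auto intro!: borel_compact)
  also have "\<dots> = (\<Sum>k\<in>Ks. ?\<mu> (cell k))"
    unfolding J_def using Ks disj
    by (intro measure_finite_Union) (auto simp: disjoint_family_on_def fmeasurableD[OF fm_cell, simplified] fmeasurableD2[OF fm_cell, simplified])
  also have "\<dots> = card Ks / N" by (simp add: meas_cell)
  finally have Ks_ge: "m / 2 \<le> card Ks / N" .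

  obtain X A S where XA: "finite (X :: 'i set)" "S > 0" "\<And>i. i \<in> X \<Longrightarrow> A i \<in> fmeasurable lborel" "\<And>i. i \<in> X \<Longrightarrow> A i \<inter> Z = {}"
    "(\<Sum>i\<in>X. \<Sum>j\<in>X. ?\<mu> (A i \<inter> A j)) \<le> 5 * S\<^sup>2"
    "\<And>k. k < N \<Longrightarrow> c * S / N \<le> (\<Sum>i\<in>X. ?\<mu> (A i \<inter> cell k))"
    using H[OF N(1)] unfolding cell_def by blast
  have "c * S * (m / 2) \<le> c * S * (card Ks / N)" using Ks_ge c XA by (intro mult_left_mono) auto
  also have "\<dots> = (\<Sum>k\<in>Ks. c * S / N)" by simp
  also have "\<dots> \<le> (\<Sum>k\<in>Ks. \<Sum>i\<in>X. ?\<mu> (A i \<inter> cell k))" by (intro sum_mono XA) (auto simp: Ks_def)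
  also have "\<dots> = (\<Sum>i\<in>X. \<Sum>k\<in>Ks. ?\<mu> (A i \<inter> cell k))" by (rule sum.swap)
  also have "\<dots> = (\<Sum>i\<in>X. ?\<mu> (A i \<inter> J))"
  proof (rule sum.cong[OF refl])
    fix i assume i: "i \<in> X"
    have fm: "A i \<inter> cell k \<in> fmeasurable lborel" for k
      using XA(3)[OF i] by (intro fmeasurable_Int_fmeasurable) (auto simp: fmeasurableD[OF fm_cell, simplified])
    have "?\<mu> (\<Union>k\<in>Ks. A i \<inter> cell k) = (\<Sum>k\<in>Ks. ?\<mu> (A i \<inter> cell k))"
      using Ks disj by (intro measure_finite_Union)
        (auto simp: disjoint_family_on_def fmeasurableD[OF fm, simplified] fmeasurableD2[OF fm, simplified])
    moreover have "(\<Union>k\<in>Ks. A i \<inter> cell k) = A i \<inter> J" by (auto simp: J_def)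
    ultimately show "(\<Sum>k\<in>Ks. ?\<mu> (A i \<inter> cell k)) = ?\<mu> (A i \<inter> J)" by simp
  qed
  also have "\<dots> = (\<Sum>i\<in>X. ?\<mu> (A i \<inter> (J - Z)))"
  proof (rule sum.cong[OF refl])
    fix i assume "i \<in> X"
    then have "A i \<inter> J = A i \<inter> (J - Z)" using XA(4) by blast
    then show "?\<mu> (A i \<inter> J) = ?\<mu> (A i \<inter> (J - Z))" by simp
  qed
  \<comment> \<open>The free parameter is taken as \<open>s / S\<close>, which balances the second
    moment \<open>5 * S\<^sup>2\<close> against the measure \<open>s\<^sup>2\<close> of
    \<open>J - Z\<close>.\<close>
  also have "\<dots> \<le> s / S / 2 * (\<Sum>i\<in>X. \<Sum>j\<in>X. ?\<mu> (A i \<inter> A j)) + ?\<mu> (J - Z) / (2 * (s / S))"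
    using XA fmJ fmZ s by (intro sum_measure_Int_le fmeasurable.Diff) auto
  also have "\<dots> \<le> s / S / 2 * (5 * S\<^sup>2) + s\<^sup>2 / (2 * (s / S))"
  proof (intro add_mono mult_left_mono divide_right_mono XA(5))
    have "emeasure lborel (J - Z) \<le> emeasure lborel (U - Z)"
      using JU U Z by (intro emeasure_mono) auto
    also have "\<dots> \<le> ennreal (s\<^sup>2)" using U by simp
    finally show "?\<mu> (J - Z) \<le> s\<^sup>2" by (simp add: measure_def enn2real_leI)
  qed (use s XA in auto)
  also have "\<dots> = 3 * s * S" using s XA(2) by (simp add: field_simps power2_eq_square)
  also have "\<dots> \<le> 3 * (c * m / 8) * S" using s XA(2) by (intro mult_right_mono mult_left_mono) auto
  finally show False using c m0 XA(2) by (simp add: field_simps)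
qed

section \<open>Heavy blocks and the families of intervals built on them\<close>

lemma eventually_sieve_error_le:
  assumes "c > 0" shows "\<forall>\<^sub>F q in sequentially. 4 * sqrt (real q) * (1 + ln (real q)) \<le> c * real q"
  using assms by real_asymp

text \<open>If every block had mass below \<open>2 ^ k\<close>, its contribution weighted by
  \<open>1 / ln q\<close> would be at most \<open>2 ^ k / 4 ^ k\<close>, and the geometric series
  sums to 2.\<close>

lemma exists_heavy_block:
  fixes \<psi> :: "nat \<Rightarrow> real"
  assumes Q: "finite Q" "\<And>q. q \<in> Q \<Longrightarrow> 1 \<le> ln (real q)" "\<And>q. q \<in> Q \<Longrightarrow> 0 \<le> \<psi> q"
    and large: "2 < (\<Sum>q\<in>Q. \<psi> q / ln (real q))"
  shows "\<exists>k. 2 ^ k \<le> (\<Sum>q | q \<in> Q \<and> 4 ^ k \<le> ln (real q) \<and> ln (real q) < 4 ^ (k + 1). \<psi> q)"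
proof (rule ccontr)
  let ?B = "\<lambda>k. {q. q \<in> Q \<and> 4 ^ k \<le> ln (real q) \<and> ln (real q) < 4 ^ (k + 1)}"
  assume "\<not> ?thesis"
  then have light: "sum \<psi> (?B k) \<le> 2 ^ k" for k by (auto simp: not_le intro: less_imp_le)
  define \<kappa> where "\<kappa> = (\<lambda>q::nat. nat \<lfloor>log 4 (ln (real q))\<rfloor>)"
  have mem: "q \<in> ?B (\<kappa> q)" if "q \<in> Q" for q
  proof -
    have y: "1 \<le> ln (real q)" using Q(2) that .
    then have "0 \<le> log 4 (ln (real q))" by simp
    then have k: "real (\<kappa> q) \<le> log 4 (ln (real q))" "log 4 (ln (real q)) < real (\<kappa> q + 1)"
      by (simp_all add: \<kappa>_def) linarith+
    from k(1) have "4 powr real (\<kappa> q) \<le> ln (real q)" using y by (subst (asm) le_log_iff) auto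
    moreover from k(2) have "ln (real q) < 4 powr real (\<kappa> q + 1)" using y by (subst (asm) log_less_iff) auto
    ultimately show ?thesis using that by (simp only: powr_realpow mem_Collect_eq zero_less_numeral)
  qed
  let ?K = "\<kappa> ` Q"
  have "(\<Sum>q\<in>Q. \<psi> q / ln (real q)) = (\<Sum>k\<in>?K. \<Sum>q | q \<in> Q \<and> \<kappa> q = k. \<psi> q / ln (real q))"
    using Q(1) by (rule sum.image_gen)
  also have "\<dots> \<le> (\<Sum>k\<in>?K. (1 / 2) ^ k)"
  proof (rule sum_mono)
    fix k
    have sub: "{q \<in> Q. \<kappa> q = k} \<subseteq> ?B k" using mem by auto
    have "(\<Sum>q | q \<in> Q \<and> \<kappa> q = k. \<psi> q / ln (real q)) \<le> (\<Sum>q | q \<in> Q \<and> \<kappa> q = k. \<psi> q / 4 ^ k)"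
    proof (rule sum_mono)
      fix q assume "q \<in> {q \<in> Q. \<kappa> q = k}"
      then have "4 ^ k \<le> ln (real q)" "0 \<le> \<psi> q" using sub Q(3) by auto
      moreover have "(0::real) < 4 ^ k" by simp
      ultimately show "\<psi> q / ln (real q) \<le> \<psi> q / 4 ^ k"
        by (intro divide_left_mono mult_pos_pos) linarith+
    qed
    also have "\<dots> \<le> (\<Sum>q\<in>?B k. \<psi> q / 4 ^ k)"
      using sub Q by (intro sum_mono2) auto
    also have "\<dots> = sum \<psi> (?B k) / 4 ^ k" by (simp add: sum_divide_distrib)
    also have "\<dots> \<le> 2 ^ k / 4 ^ k" using light by (intro divide_right_mono) auto
    also have "\<dots> = (1 / 2) ^ k" by (simp flip: power_divide)
    finally show "(\<Sum>q | q \<in> Q \<and> \<kappa> q = k. \<psi> q / ln (real q)) \<le> (1 / 2) ^ k" .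
  qed
  also have "\<dots> \<le> (\<Sum>k. (1 / 2) ^ k)"
    using Q(1) by (intro sum_le_suminf) (auto simp: summable_geometric)
  also have "\<dots> = 2" by (simp add: suminf_geometric)
  finally show False using large by simp
qed

text \<open>Combines the scale selection with the lower bound on each cell. The condition comparing
  \<open>2 ^ k\<close> with the square of \<open>2 * r ^ nat r\<close> makes the mass large enough
  to absorb the contribution of coinciding centres at every admissible scale
  \<open>\<theta>\<close>.\<close>

lemma exists_spread_family:
  fixes a r :: int and B :: "nat set" and \<psi> :: "nat \<Rightarrow> real" and k N :: nat
  assumes r: "r \<ge> 2" "coprime a r" and k: "32 \<le> k" "(2 * real_of_int r ^ nat r)\<^sup>2 \<le> 2 ^ k" and N: "N > 0"
    and B: "finite B" "\<And>q. q \<in> B \<Longrightarrow> 4 ^ k \<le> ln (real q)" "\<And>q. q \<in> B \<Longrightarrow> ln (real q) < 4 ^ (k + 1)"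
    and \<psi>: "\<And>q. q \<in> B \<Longrightarrow> 0 < \<psi> q" "\<And>q. q \<in> B \<Longrightarrow> \<psi> q \<le> 1 / 2" "2 ^ k \<le> sum \<psi> B"
    and large: "\<And>q. q \<in> B \<Longrightarrow> N \<le> q"
      "\<And>q. q \<in> B \<Longrightarrow> 4 * sqrt (real q) * (1 + ln (real q)) \<le> exp (- 144) / (8 * N) * real q"
  shows "\<exists>(X :: (nat \<times> int) set) A S. finite X \<and> S > 0
    \<and> (\<forall>i\<in>X. A i \<in> fmeasurable lborel \<and>
        (\<forall>x\<in>A i. \<exists>q\<in>B. \<exists>t::int. \<bar>real q * x - real_of_int a / real_of_int r - real_of_int t\<bar> \<le> \<psi> q / 2))
    \<and> (\<Sum>i\<in>X. \<Sum>j\<in>X. measure lborel (A i \<inter> A j)) \<le> 5 * S\<^sup>2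
    \<and> (\<forall>l<N. exp (- 144) / 8 * S / N \<le> (\<Sum>i\<in>X. measure lborel (A i \<inter> {real l / N..<(real l + 1) / N})))"
proof -
  \<comment> \<open>Chosen so that \<open>exp (32 * h) = 4 ^ k\<close>, the left end of the block;
    the gcd bound \<open>exp (8 * h)\<close> is then the square root of
    \<open>2 ^ k\<close>.\<close>
  define h where "h = real k * ln 4 / 32"
  have ln4: "ln 4 \<ge> (1::real)"
    using ln2_ge_two_thirds ln_mult[of 2 "2::real"] by simp
  have "real k * ln 4 \<ge> 32 * 1" using k(1) ln4 by (intro mult_mono) auto
  then have h1: "h \<ge> 1" by (simp add: h_def)
  have h32: "exp (32 * h) = 4 ^ k"
    by (simp add: h_def exp_of_nat_mult)
  define Y where "Y = exp (8 * h)"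
  have Y: "Y > 0" "Y\<^sup>2 = 2 ^ k"
  proof -
    have "Y\<^sup>2 = exp (real k * (ln 4 / 2))" by (simp add: Y_def h_def power2_eq_square flip: exp_add)
    also have "\<dots> = exp (ln 4 / 2) ^ k" by (rule exp_of_nat_mult)
    also have "ln 4 / 2 = (ln 2 :: real)" using ln_mult[of 2 "2::real"] by simp
    finally show "Y\<^sup>2 = 2 ^ k" by simp
  qed (simp add: Y_def)
  have hB: "exp (32 * h) \<le> ln (real q)" "ln (real q) < 4 * exp (32 * h)" if "q \<in> B" for q
    using B that by (auto simp: h32)
  have qpos: "q > 0" if "q \<in> B" for q using large(1)[OF that] N by simp
  let ?X = "Sigma B (centres a r Y)"
  obtain \<theta> :: real where \<theta>: "2 \<le> \<theta>" "\<theta> \<le> 2 * r ^ nat r" and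
    overlaps: "(\<Sum>i\<in>?X. \<Sum>j\<in>?X. measure lborel
      ((\<lambda>(q, P). {real_of_int P / (r * q)..real_of_int P / (r * q) + \<psi> q / (\<theta> * q)}) i
       \<inter> (\<lambda>(q, P). {real_of_int P / (r * q)..real_of_int P / (r * q) + \<psi> q / (\<theta> * q)}) j))
     \<le> 4 * (sum \<psi> B / \<theta>)\<^sup>2 + Y * (sum \<psi> B / \<theta>)"
    using exists_scale_sum_overlaps_le[OF r(1) less_imp_le[OF Y(1)] B(1), where \<psi> = \<psi> and a = a, OF qpos \<psi>(1)] by blast
  define S where "S = sum \<psi> B / \<theta>"
  define A where "A = (\<lambda>(q, P). {real_of_int P / (r * q)..real_of_int P / (r * q) + \<psi> q / (\<theta> * q)})"
  \<comment> \<open>From \<open>\<theta> \<le> Y\<close> and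
    \<open>Y\<^sup>2 = 2 ^ k \<le> sum \<psi> B\<close>. Hence the term \<open>Y * S\<close> is at
    most \<open>S\<^sup>2\<close>, turning the constant 4 into 5.\<close>
  have YS: "Y \<le> S"
  proof -
    have "(2 * real_of_int r ^ nat r)\<^sup>2 \<le> Y\<^sup>2" using k(2) Y(2) by simp
    then have "2 * real_of_int r ^ nat r \<le> Y" using Y(1) by (rule power2_le_imp_le[OF _ less_imp_le])
    then have "\<theta> * Y \<le> Y * Y" using \<theta>(2) Y(1) by (intro mult_right_mono) auto
    also have "\<dots> \<le> sum \<psi> B" using Y(2) \<psi>(3) by (simp add: power2_eq_square)
    finally show ?thesis using \<theta>(1) by (simp add: S_def pos_le_divide_eq mult.commute)
  qed
  then have S0: "S > 0" using Y(1) by linarith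
  show ?thesis
  proof (intro exI[of _ ?X] exI[of _ A] exI[of _ S] conjI ballI allI impI)
    show "finite ?X" using B(1) by simp
    show "S > 0" by (rule S0)
    show "A i \<in> fmeasurable lborel" for i by (cases i) (simp add: A_def fmeasurable_Icc)
    have "Y * S \<le> S * S" using YS S0 by (intro mult_right_mono) auto
    then show "(\<Sum>i\<in>?X. \<Sum>j\<in>?X. measure lborel (A i \<inter> A j)) \<le> 5 * S\<^sup>2"
      using overlaps unfolding S_def[symmetric] A_def[symmetric] by (simp add: power2_eq_square)
  next
    fix i x assume "i \<in> ?X" "x \<in> A i"
    then obtain q P where q: "q \<in> B" "P \<in> centres a r Y q"
      and x: "P / (r * q) \<le> x" "x \<le> P / (r * q) + \<psi> q / (\<theta> * q)" by (auto simp: A_def)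
    have "[P = a] (mod r)" using q(2) by (simp add: centres_def)
    then obtain t where t: "P = a + r * t" by (metis add.commute cong_iff_lin cong_sym mult.commute)
    have "P / r = a / r + t" using r by (simp add: t field_simps)
    moreover have "P / r \<le> q * x" using x(1) r qpos[OF q(1)] by (simp add: field_simps)
    moreover have "q * x \<le> P / r + \<psi> q / \<theta>" 
    proof -
      have "q * x \<le> q * (P / (r * q) + \<psi> q / (\<theta> * q))" using x(2) by (intro mult_left_mono) auto
      also have "\<dots> = P / r + \<psi> q / \<theta>" using qpos[OF q(1)] r \<theta>(1) by (simp add: distrib_left)
      finally show ?thesis .
    qed
    \<comment> \<open>Half of \<open>\<psi> q\<close> is kept in reserve for replacing
      \<open>a / r\<close> by the limit of the dyadic series.\<close>
    moreover have "\<psi> q / \<theta> \<le> \<psi> q / 2"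
      using \<theta>(1) \<psi>(1)[OF q(1)] by (intro divide_left_mono) auto
    ultimately have "\<bar>real q * x - real_of_int a / real_of_int r - real_of_int t\<bar> \<le> \<psi> q / 2" by linarith
    then show "\<exists>q\<in>B. \<exists>t::int. \<bar>real q * x - real_of_int a / real_of_int r - real_of_int t\<bar> \<le> \<psi> q / 2" using q(1) by blast
  next
    fix l assume l: "l < N"
    let ?I = "{real l / N..<(real l + 1) / N}"
    have "exp (- 144) / 8 * S / N = (\<Sum>q\<in>B. exp (- 144) / 8 * (q * (\<psi> q / (\<theta> * q))) / N)"
      unfolding S_def sum_divide_distrib sum_distrib_left using qpos by (intro sum.cong refl) auto
    also have "\<dots> \<le> (\<Sum>q\<in>B. \<Sum>P\<in>centres a r (exp (8 * h)) q. measure lborel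
       ({real_of_int P / (r * q)..real_of_int P / (r * q) + \<psi> q / (\<theta> * q)} \<inter> ?I))"
    proof (intro sum_mono sum_measure_cell_ge)
      fix q assume q: "q \<in> B"
      show "1 \<le> h" by (rule h1)
      show "exp (32 * h) \<le> ln (real q)" "ln (real q) < 4 * exp (32 * h)" using hB q by auto
      show "r > 0" "coprime a r" using r by auto
      show "l < N" by (rule l)
      show "0 \<le> \<psi> q / (\<theta> * q)" using \<psi>(1)[OF q] \<theta>(1) by simp
      have "\<psi> q * (2 * N) \<le> 1 / 2 * (2 * q)" using \<psi>(1,2)[OF q] large(1)[OF q] by (intro mult_mono) auto
      also have "\<dots> \<le> \<theta> * q" using mult_right_mono[of 1 \<theta> "real q"] \<theta>(1) by simp
      finally show "\<psi> q / (\<theta> * q) \<le> 1 / (2 * N)" using \<theta>(1) qpos[OF q] N by (simp add: field_simps)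
      show "4 * sqrt (real q) * (1 + ln (real q)) \<le> real q / (2 * N) * exp (- 144) / 4"
        using large(2)[OF q] by (simp add: field_simps)
    qed
    also have "\<dots> = (\<Sum>i\<in>?X. measure lborel (A i \<inter> ?I))"
      unfolding Y_def[symmetric] A_def using B(1) by (subst sum.Sigma) (auto simp: case_prod_unfold)
    finally show "exp (- 144) / 8 * S / N \<le> (\<Sum>i\<in>?X. measure lborel (A i \<inter> ?I))" .
  qed
qed

section \<open>A lacunary Liouville number\<close>

text \<open>The \<open>j\<close>-th partial sum over the denominator \<open>2 ^ n j\<close> has an
  odd numerator: the last term contributes 1 and all earlier ones an even number, \<open>n\<close>
  being strictly increasing. The tail is dominated by a geometric series. Oddness later gives
  coprimality to the denominator.\<close>

lemma lacunary_dyadic_series: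
  fixes n :: "nat \<Rightarrow> nat"
  assumes n0: "n 0 \<ge> 1" and step: "\<And>j. n (Suc j) \<ge> (j + 2) * n j"
  defines "\<gamma> \<equiv> \<Sum>j. (1 / 2 :: real) ^ n j"
  shows "\<exists>a::int. odd a \<and> 0 < \<gamma> - a / 2 ^ n j \<and> \<gamma> - a / 2 ^ n j \<le> 2 * (1 / 2) ^ n (Suc j)"
proof -
  let ?z = "1 / 2 :: real"
  have n1: "n j \<ge> 1" for j
  proof (induction j)
    case (Suc j)
    then have "1 * 1 \<le> (j + 2) * n j" by (intro mult_mono) auto
    then show ?case using step[of j] by linarith
  qed (rule n0)
  have lt: "n j < n (Suc j)" for j
  proof -
    have "n j < 2 * n j" using n1[of j] by simp
    also have "\<dots> \<le> (j + 2) * n j" by (intro mult_right_mono) auto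
    finally show ?thesis using step[of j] by linarith
  qed
  have shift: "n j + m \<le> n (j + m)" for j m
  proof (induction m)
    case (Suc m)
    then show ?case using lt[of "j + m"] by simp
  qed simp
  have le: "?z ^ n (j + m) \<le> ?z ^ n j * ?z ^ m" for j m
    unfolding power_add[symmetric] using shift by (intro power_decreasing) auto
  have geo: "summable (\<lambda>m. c * ?z ^ m)" for c by (intro summable_mult summable_geometric) auto
  have summ: "summable (\<lambda>m. ?z ^ n (j + m))" for j
    using le[of j] by (intro summable_comparison_test'[OF geo[of "?z ^ n j"]]) auto
  have sum0: "summable (\<lambda>j. ?z ^ n j)" using summ[of 0] by simp
  have part: "\<exists>a::int. odd a \<and> (\<Sum>i<Suc j. ?z ^ n i) = a / 2 ^ n j" for j
  proof (induction j)
    case 0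
    show ?case by (rule exI[of _ 1]) (simp add: power_one_over)
  next
    case (Suc j)
    then obtain a :: int where a: "odd a" "(\<Sum>i<Suc j. ?z ^ n i) = a / 2 ^ n j" by blast
    define d where "d = n (Suc j) - n j"
    have d: "n (Suc j) = n j + d" "d > 0" using lt[of j] by (auto simp: d_def)
    have "(\<Sum>i<Suc (Suc j). ?z ^ n i) = a / 2 ^ n j + 1 / 2 ^ n (Suc j)"
      using a(2) by (simp add: power_one_over)
    also have "\<dots> = of_int (a * 2 ^ d + 1) / 2 ^ n (Suc j)" unfolding d(1) by (simp add: power_add field_simps)
    finally have F: "(\<Sum>i<Suc (Suc j). ?z ^ n i) = of_int (a * 2 ^ d + 1) / 2 ^ n (Suc j)" .
    show ?case
    proof (intro exI conjI)
      show "odd (a * 2 ^ d + 1)" using d(2) by simp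
    qed (rule F)
  qed
  from part[of j] obtain a :: int where a: "odd a" "(\<Sum>i<Suc j. ?z ^ n i) = a / 2 ^ n j" by blast
  have split: "\<gamma> = (\<Sum>m. ?z ^ n (Suc j + m)) + a / 2 ^ n j"
    unfolding \<gamma>_def a(2)[symmetric] using suminf_split_initial_segment[OF sum0, of "Suc j"]
    by (simp add: add.commute)
  have "0 < (\<Sum>m. ?z ^ n (Suc j + m))" using summ[of "Suc j"] by (intro suminf_pos) auto
  moreover have "(\<Sum>m. ?z ^ n (Suc j + m)) \<le> (\<Sum>m. ?z ^ n (Suc j) * ?z ^ m)"
    by (intro suminf_le summ geo le)
  moreover have "(\<Sum>m. ?z ^ n (Suc j) * ?z ^ m) = ?z ^ n (Suc j) * 2"
    by (subst suminf_mult) (auto simp: summable_geometric suminf_geometric)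
  ultimately show ?thesis using a(1) split by (intro exI[of _ a]) auto
qed

text \<open>The error is at most \<open>2 powr (1 - n (Suc j))\<close>, and
  \<open>n (Suc j) \<ge> (j + 2) * n j\<close> beats the exponent \<open>w * n j\<close> as soon as
  \<open>j > w\<close>. If the limit were \<open>p / q\<close>, its positive difference from the
  \<open>j\<close>-th fraction would be at least \<open>1 / (q * 2 ^ n j)\<close>, which fails once
  \<open>2 ^ j > q\<close>.\<close>

lemma liouville_if_lacunary:
  fixes n :: "nat \<Rightarrow> nat"
  assumes n0: "n 0 \<ge> 1" and step: "\<And>j. n (Suc j) \<ge> (j + 2) * n j"
    and approx: "\<And>j. \<exists>a::int. 0 < \<gamma> - a / 2 ^ n j \<and> \<gamma> - a / 2 ^ n j \<le> 2 * (1 / 2) ^ n (Suc j)"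
  shows "liouville \<gamma>"
proof -
  obtain a :: "nat \<Rightarrow> int" where a: "\<And>j. 0 < \<gamma> - a j / 2 ^ n j"
    "\<And>j. \<gamma> - a j / 2 ^ n j \<le> 2 * (1 / 2) ^ n (Suc j)" using approx by metis
  have n1: "n j \<ge> 1" for j
  proof (induction j)
    case (Suc j)
    then have "1 * 1 \<le> (j + 2) * n j" by (intro mult_mono) auto
    then show ?case using step[of j] by linarith
  qed (rule n0)
  have gap: "n j + (j + 1) \<le> n (Suc j)" for j
  proof -
    have "(j + 1) * 1 \<le> (j + 1) * n j" using n1[of j] by (intro mult_left_mono) auto
    then show ?thesis using step[of j] by (simp add: algebra_simps)
  qed
  have "\<gamma> \<notin> \<rat>"
  proof
    assume "\<gamma> \<in> \<rat>"
    then obtain p q :: int where pq: "q > 0" "\<gamma> = p / q" by (elim Rats_cases') auto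
    obtain j where j: "real_of_int q < 2 ^ j" using real_arch_pow[of 2 "real_of_int q"] by auto
    have eq: "\<gamma> - a j / 2 ^ n j = real_of_int (p * 2 ^ n j - a j * q) / (real_of_int q * 2 ^ n j)"
      using pq by (simp add: field_simps)
    have c: "0 < real_of_int q * 2 ^ n j" using pq(1) by simp
    have "0 < real_of_int (p * 2 ^ n j - a j * q)"
      using a(1)[of j] unfolding eq pos_less_divide_eq[OF c] by simp
    then have "1 \<le> real_of_int (p * 2 ^ n j - a j * q)"
      unfolding of_int_0_less_iff of_int_1_le_iff by simp
    then have "1 / (real_of_int q * 2 ^ n j) \<le> \<gamma> - a j / 2 ^ n j"
      unfolding eq using pq(1) by (intro divide_right_mono) auto
    also have "\<dots> \<le> 2 * (1 / 2) ^ n (Suc j)" by (rule a)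
    also have "\<dots> \<le> 2 * (1 / 2) ^ (n j + (j + 1))"
      using gap by (intro mult_left_mono power_decreasing) auto
    also have "\<dots> = 1 / (2 ^ j * 2 ^ n j)" by (simp add: power_add power_one_over)
    finally have "2 ^ j * 2 ^ n j \<le> real_of_int q * 2 ^ n j" using pq(1) by (simp add: field_simps)
    with j show False by simp
  qed
  moreover have "infinite {(p :: int, q :: int). q > 0 \<and> \<bar>\<gamma> - of_int p / of_int q\<bar> < of_int q powr (-w)}"
    if w: "w > 0" for w
  proof -
    obtain j0 :: nat where j0: "w < real j0" using reals_Archimedean2 by blast
    let ?f = "\<lambda>j. (a j, 2 ^ n j :: int)"
    have "n j < n (Suc j)" for j using gap[of j] by linarith
    then have mono: "strict_mono n" by (simp add: strict_mono_Suc_iff)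
    have "inj ?f" by (rule injI) (auto simp: strict_mono_eq[OF mono])
    then have "infinite (?f ` {j0..})" by (simp add: finite_image_iff inj_on_subset infinite_Ici)
    moreover have "?f ` {j0..} \<subseteq> {(p, q). q > 0 \<and> \<bar>\<gamma> - of_int p / of_int q\<bar> < of_int q powr (-w)}"
    proof (rule image_subsetI)
      fix j assume "j \<in> {j0..}"
      then have "w < real j" using j0 by simp
      have "\<bar>\<gamma> - a j / 2 ^ n j\<bar> \<le> 2 * (1 / 2) ^ n (Suc j)" using a[of j] by simp
      also have "\<dots> = 2 powr (1 - real (n (Suc j)))"
        by (simp add: powr_diff powr_realpow power_one_over)
      also have "\<dots> < 2 powr (- (w * n j))"
      proof -
        have "w * n j < real j * real (n j)" using \<open>w < real j\<close> n1[of j] by (intro mult_strict_right_mono) auto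
        moreover have "real ((j + 2) * n j) \<le> real (n (Suc j))" using step[of j] by (simp only: of_nat_le_iff)
        then have "real j * real (n j) + 2 * real (n j) \<le> real (n (Suc j))" by (simp add: algebra_simps)
        moreover have "real (n j) \<ge> 1" using n1[of j] by simp
        ultimately have "1 - real (n (Suc j)) < - (w * n j)" by linarith
        then show ?thesis by (rule powr_less_mono) simp
      qed
      also have "\<dots> = (2 powr n j) powr (- w)" by (simp add: powr_powr mult.commute)
      also have "\<dots> = real_of_int (2 ^ n j) powr (- w)" by (simp add: powr_realpow)
      finally show "?f j \<in> {(p, q). q > 0 \<and> \<bar>\<gamma> - of_int p / of_int q\<bar> < of_int q powr (-w)}" by simp
    qed
    ultimately show ?thesis using finite_subset by blast
  qed
  ultimately show ?thesis by (simp add: liouville_def)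
qed

section \<open>The main theorem\<close>

lemma dist_int_le: "dist_int y \<le> \<bar>y - of_int t\<bar>"
  unfolding dist_int_def by (rule round_diff_minimal)

lemma dist_int_le_half: "dist_int y \<le> 1 / 2"
  unfolding dist_int_def using of_int_round_abs_le[of y] by (simp add: abs_minus_commute)

lemma dist_int_add_int: "dist_int (y + of_int t) = dist_int y"
proof (rule antisym)
  have le: "dist_int (z + of_int s) \<le> dist_int z" for z s
    using dist_int_le[of "z + of_int s" "round z + s"] unfolding dist_int_def[of z] by simp
  show "dist_int (y + of_int t) \<le> dist_int y" by (rule le)
  show "dist_int y \<le> dist_int (y + of_int t)" using le[of "y + of_int t" "- t"] by simp
qed

lemma borel_measurable_dist_int [measurable]: "dist_int \<in> borel_measurable borel"
  unfolding dist_int_def[abs_def] round_def by measurable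

lemma sum_inverse_squares_le: "(\<Sum>q=1..n. 1 / (real q)\<^sup>2) \<le> 2"
proof -
  have "(\<Sum>q=1..n. 1 / (real q)\<^sup>2) \<le> 2 - 1 / n" if "n \<ge> 1"
    using that
  proof (induction n rule: dec_induct)
    case (step n)
    have "1 / (real (Suc n))\<^sup>2 \<le> 1 / n - 1 / Suc n"
    proof -
      have "1 / real n - 1 / real (Suc n) = 1 / (real n * real (Suc n))" using step by (simp add: field_simps)
      moreover have "1 / (real (Suc n))\<^sup>2 \<le> 1 / (real n * real (Suc n))"
        using step by (intro divide_left_mono) (auto simp: power2_eq_square)
      ultimately show ?thesis by simp
    qed
    with step show ?case by simp
  qed simp
  then show ?thesis by (cases n) (auto intro: order_trans)
qed

section \<open>Reduction of the divergence conditions and choice of the ranges\<close>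

lemma Log_ge_1: "1 \<le> Log x"
  by (simp add: Log_def)

text \<open>\<open>g\<close> stands for the summand of either divergence condition. Both are
  dominated by \<open>\<psi> q / Log q\<close>, so both lead to the same lower bound.\<close>

lemma eventually_weighted_sum_ge:
  fixes f g \<psi> :: "nat \<Rightarrow> real"
  assumes f: "filterlim f at_top sequentially"
    and g: "\<And>q. q \<ge> 1 \<Longrightarrow> g q \<le> \<psi> q / Log (real q)"
    and lim: "Liminf sequentially (\<lambda>Q. ereal ((1 / f Q) * (\<Sum>q\<in>{1..Q}. g q))) > 0"
  shows "\<exists>c>0. \<forall>\<^sub>F Q in sequentially. c * f Q \<le> (\<Sum>q\<in>{1..Q}. \<psi> q / Log (real q))"
proof -
  obtain c :: real where c: "0 < ereal c" "ereal c < Liminf sequentially (\<lambda>Q. ereal ((1 / f Q) * (\<Sum>q\<in>{1..Q}. g q)))"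
    using ereal_dense2[OF lim] by blast
  have "\<forall>\<^sub>F Q in sequentially. ereal c < ereal ((1 / f Q) * (\<Sum>q\<in>{1..Q}. g q))"
    using less_LiminfD[OF c(2)] .
  moreover have "\<forall>\<^sub>F Q in sequentially. f Q > 0" using f by (auto simp: filterlim_at_top_dense)
  ultimately have "\<forall>\<^sub>F Q in sequentially. c * f Q \<le> (\<Sum>q\<in>{1..Q}. \<psi> q / Log (real q))"
  proof eventually_elim
    case (elim Q)
    then have "c * f Q \<le> (\<Sum>q\<in>{1..Q}. g q)" by (simp add: field_simps)
    also have "\<dots> \<le> (\<Sum>q\<in>{1..Q}. \<psi> q / Log (real q))" by (intro sum_mono g) auto
    finally show ?case .
  qed
  with c(1) show ?thesis by auto
qed

text \<open>\<open>U\<close> is taken beyond \<open>exp (4 ^ k0)\<close>, so a block containing some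
  \<open>q > U\<close> has index at least \<open>k0\<close>; \<open>V\<close> is then chosen after
  \<open>U\<close> using the growth of \<open>f\<close>. Nothing here refers to
  \<open>\<psi>\<close>; the factor \<open>j\<close> is there to overtake every constant that
  depends on \<open>\<psi>\<close>.\<close>

lemma exists_stage:
  fixes f :: "nat \<Rightarrow> real" and C :: real
  assumes f: "filterlim f at_top sequentially"
  shows "\<exists>U V. j \<le> U \<and> 3 \<le> U \<and> real j * (real U + 1) \<le> f V \<and> j \<le> V \<and>
    (\<forall>q k. U < q \<longrightarrow> ln (real q) < 4 ^ (k + 1) \<longrightarrow> 32 \<le> k \<and> C \<le> 2 ^ k)"
proof -
  obtain k1 where k1: "C < 2 ^ k1" using real_arch_pow[of 2 C] by auto
  define k0 where "k0 = max 32 k1"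
  have k0: "32 \<le> k0" "C \<le> 2 ^ k0"
  proof -
    have "(2::real) ^ k1 \<le> 2 ^ k0" by (intro power_increasing) (auto simp: k0_def)
    with k1 show "C \<le> 2 ^ k0" by linarith
  qed (simp add: k0_def)
  define U where "U = max (max j 3) (nat \<lceil>exp ((4::real) ^ k0)\<rceil>)"
  have "\<forall>\<^sub>F V in sequentially. real j * (real U + 1) \<le> f V \<and> j \<le> V"
    using f by (intro eventually_conj eventually_ge_at_top) (simp add: filterlim_at_top)
  then obtain V where V: "real j * (real U + 1) \<le> f V" "j \<le> V"
    by (metis (no_types, lifting) eventually_happens' sequentially_bot)
  have "32 \<le> k \<and> C \<le> 2 ^ k" if "U < q" "ln (real q) < 4 ^ (k + 1)" for q k
  proof -
    have "exp ((4::real) ^ k0) \<le> real (nat \<lceil>exp ((4::real) ^ k0)\<rceil>)" by (rule real_nat_ceiling_ge)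
    also have "\<dots> \<le> real q" unfolding of_nat_le_iff using that(1) unfolding U_def max_less_iff_conj
      by (blast intro: less_imp_le)
    finally have "ln (exp ((4::real) ^ k0)) \<le> ln (real q)" by (intro ln_mono) auto
    then have "(4::real) ^ k0 < 4 ^ (k + 1)" using that(2) by simp
    then have "k0 < k + 1" by (subst (asm) power_strict_increasing_iff) auto
    then have "k0 \<le> k" by simp
    moreover from this have "(2::real) ^ k0 \<le> 2 ^ k" by (intro power_increasing) auto
    ultimately show ?thesis using k0 by linarith
  qed
  then show ?thesis using V by (intro exI[of _ U] exI[of _ V]) (auto simp: U_def)
qed

text \<open>The integer translates of \<open>N\<close> cover \<open>Z\<close>. The conclusion is a
  null cover, since measurability of \<open>Z\<close> is not assumed.\<close>

lemma null_sets_if_periodic: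
  fixes Z :: "real set"
  assumes "Z \<inter> {0..<1} \<subseteq> N" and "N \<in> null_sets lborel" and "\<And>x t. x \<in> Z \<Longrightarrow> x - of_int t \<in> Z"
  shows "\<exists>N'\<in>null_sets lborel. Z \<subseteq> N'"
proof
  show "(\<Union>t::int. {x. x - of_int t \<in> N}) \<in> null_sets lborel"
    using assms(2) by (intro null_sets_UN null_sets_translation)
  show "Z \<subseteq> (\<Union>t::int. {x. x - of_int t \<in> N})"
  proof
    fix x assume "x \<in> Z"
    then have "x - of_int \<lfloor>x\<rfloor> \<in> Z \<inter> {0..<1}" using assms(3) by auto linarith
    then show "x \<in> (\<Union>t::int. {x. x - of_int t \<in> N})" using assms(1) by blast
  qed
qed

theorem mainTheorem15:
  fixes f :: "nat \<Rightarrow> real"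
  assumes "mono f" and "filterlim f at_top sequentially"
  shows "\<exists>\<gamma>. liouville \<gamma> \<and>
    (\<forall>\<psi> :: nat \<Rightarrow> real. (\<forall>q\<ge>1. \<psi> q \<ge> 0) \<longrightarrow>
       ((\<exists>\<epsilon>>0. Liminf sequentially (\<lambda>Q. ereal ((1 / f Q) *
            (\<Sum>q\<in>{1..Q}. \<psi> q * real (totient q) /
               (real q * Log (real q) * Log (Log (real q)) powr (1 + \<epsilon>))))) > 0)
        \<or> (\<exists>\<epsilon>>0. Liminf sequentially (\<lambda>Q. ereal ((1 / f Q) *
            (\<Sum>q\<in>{1..Q}. \<psi> q /
               (Log (real q) * Log (Log (real q)) powr (2 + \<epsilon>))))) > 0))
       \<longrightarrow> (AE x in lborel. infinite {q :: nat. q \<ge> 1 \<and> dist_int (real q * x - \<gamma>) \<le> \<psi> q}))"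
proof -
  \<comment> \<open>For \<open>r = 2 ^ m\<close> this is the bound on \<open>2 ^ k\<close> that
    \<open>exists_spread_family\<close> demands.\<close>
  define C where "C = (\<lambda>m::nat. (2 * real_of_int (2 ^ m) ^ nat (2 ^ m))\<^sup>2)"
  define stage where "stage = (\<lambda>j m U V. j \<le> U \<and> 3 \<le> U \<and> real j * (real U + 1) \<le> f V \<and> j \<le> V \<and>
    (\<forall>q k. U < q \<longrightarrow> ln (real q) < 4 ^ (k + 1) \<longrightarrow> 32 \<le> k \<and> C m \<le> 2 ^ k))"
  have "\<exists>U V. stage j m U V" for j m unfolding stage_def by (rule exists_stage[OF assms(2)])
  then obtain U V where UV: "\<And>j m. stage j m (U j m) (V j m)" by metis
  \<comment> \<open>The summand \<open>(j + 2) * m\<close> yields the Liouville property. The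
    summand \<open>2 * V j m + 2\<close> makes the approximation error at most
    \<open>1 / (2 * V\<^sup>2)\<close>. The range depends on the current exponent \<open>m\<close>,
    hence the recursion.\<close>
  define n where "n = rec_nat 1 (\<lambda>j m. (j + 2) * m + (2 * V j m + 2))"
  have n: "n 0 = 1" "n (Suc j) = (j + 2) * n j + (2 * V j (n j) + 2)" for j by (simp_all add: n_def)
  define \<gamma> where "\<gamma> = (\<Sum>j. (1 / 2 :: real) ^ n j)"
  have approx: "\<exists>a::int. odd a \<and> 0 < \<gamma> - a / 2 ^ n j \<and> \<gamma> - a / 2 ^ n j \<le> 2 * (1 / 2) ^ n (Suc j)" for j
    unfolding \<gamma>_def by (rule lacunary_dyadic_series) (simp_all add: n)
  have "liouville \<gamma>" by (rule liouville_if_lacunary[of n]) (use approx n in \<open>auto\<close>)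
  moreover have "AE x in lborel. infinite {q :: nat. q \<ge> 1 \<and> dist_int (real q * x - \<gamma>) \<le> \<psi> q}"
    if \<psi>0: "\<forall>q\<ge>1. \<psi> q \<ge> 0" and cond: "(\<exists>\<epsilon>>0. Liminf sequentially (\<lambda>Q. ereal ((1 / f Q) *
            (\<Sum>q\<in>{1..Q}. \<psi> q * real (totient q) /
               (real q * Log (real q) * Log (Log (real q)) powr (1 + \<epsilon>))))) > 0)
        \<or> (\<exists>\<epsilon>>0. Liminf sequentially (\<lambda>Q. ereal ((1 / f Q) *
            (\<Sum>q\<in>{1..Q}. \<psi> q /
               (Log (real q) * Log (Log (real q)) powr (2 + \<epsilon>))))) > 0)" for \<psi> :: "nat \<Rightarrow> real"
  proof -
    have LL: "1 \<le> Log (Log x) powr s" if "s \<ge> 0" for x s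
      using Log_ge_1 that by (rule ge_one_powr_ge_zero)
    have g1: "\<psi> q * real (totient q) / (real q * Log (real q) * Log (Log (real q)) powr (1 + \<epsilon>)) \<le> \<psi> q / Log (real q)"
      if "\<epsilon> > 0" "q \<ge> 1" for \<epsilon> q
    proof -
      have "real (totient q) \<le> real q" by (simp add: totient_le)
      then have "real (totient q) / real q \<le> 1" using that by simp
      then have "\<psi> q * (real (totient q) / real q) \<le> \<psi> q * 1" using \<psi>0 that by (intro mult_left_mono) auto
      moreover have "Log (real q) * 1 \<le> Log (real q) * Log (Log (real q)) powr (1 + \<epsilon>)"
        using Log_ge_1[of "real q"] LL[of "1 + \<epsilon>" "real q"] that by (intro mult_left_mono) auto
      ultimately have "\<psi> q * (real (totient q) / real q) / (Log (real q) * Log (Log (real q)) powr (1 + \<epsilon>)) \<le> \<psi> q / Log (real q)"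
        using \<psi>0 that Log_ge_1[of "real q"] by (intro frac_le) auto
      then show ?thesis by (simp add: mult.assoc)
    qed
    have g2: "\<psi> q / (Log (real q) * Log (Log (real q)) powr (2 + \<epsilon>)) \<le> \<psi> q / Log (real q)"
      if "\<epsilon> > 0" "q \<ge> 1" for \<epsilon> q
    proof -
      have "Log (real q) * 1 \<le> Log (real q) * Log (Log (real q)) powr (2 + \<epsilon>)"
        using Log_ge_1[of "real q"] LL[of "2 + \<epsilon>" "real q"] that by (intro mult_left_mono) auto
      then show ?thesis using \<psi>0 that Log_ge_1[of "real q"] by (intro frac_le) auto
    qed
    have "\<exists>c>0. \<forall>\<^sub>F Q in sequentially. c * f Q \<le> (\<Sum>q\<in>{1..Q}. \<psi> q / Log (real q))"
      using cond
      by (elim disjE exE conjE)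
        (rule eventually_weighted_sum_ge[OF assms(2) g1], assumption+,
         rule eventually_weighted_sum_ge[OF assms(2) g2], assumption+)
    then obtain c where c: "c > 0" "\<forall>\<^sub>F Q in sequentially. c * f Q \<le> (\<Sum>q\<in>{1..Q}. \<psi> q / Log (real q))"
      by blast
    show ?thesis
    \<comment> \<open>If \<open>\<psi> q \<ge> 1 / 2\<close> infinitely often, every
      \<open>x\<close> works, since \<open>dist_int\<close> never exceeds \<open>1 / 2\<close>.
      Otherwise \<open>\<psi>\<close> is below \<open>1 / 2\<close> from some point on, so the
      \<open>q \<le> u\<close> carry weighted mass at most a constant plus \<open>u\<close>.\<close>
    proof (cases "finite {q. q \<ge> 1 \<and> 1 / 2 \<le> \<psi> q}")
      case False
      have "{q. q \<ge> 1 \<and> 1 / 2 \<le> \<psi> q} \<subseteq> {q. q \<ge> 1 \<and> dist_int (real q * x - \<gamma>) \<le> \<psi> q}" for x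
        using order_trans[OF dist_int_le_half] by blast
      with False have "infinite {q. q \<ge> 1 \<and> dist_int (real q * x - \<gamma>) \<le> \<psi> q}" for x
        using finite_subset by blast
      then show ?thesis by simp
    next
      case True
      from True[unfolded finite_nat_set_iff_bounded]
      obtain q1 where q1': "\<forall>q\<in>{q. q \<ge> 1 \<and> 1 / 2 \<le> \<psi> q}. q < q1" ..
      have q1: "\<psi> q < 1 / 2" if "q \<ge> q1" "q \<ge> 1" for q
        using q1'[rule_format, of q] that by (auto simp: not_less[symmetric])
      define Cs where "Cs = (\<Sum>q\<in>{1..q1}. \<psi> q)"
      have Cs0: "Cs \<ge> 0" unfolding Cs_def using \<psi>0 by (intro sum_nonneg) auto
      have early: "(\<Sum>q\<in>{1..u}. \<psi> q / Log (real q)) \<le> Cs + u" for u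
      proof -
        have "(\<Sum>q\<in>{1..u}. \<psi> q / Log (real q)) \<le> (\<Sum>q\<in>{1..u}. (if q \<in> {1..q1} then \<psi> q else 0) + 1)"
        proof (rule sum_mono)
          fix q assume q: "q \<in> {1..u}"
          have "\<psi> q / Log (real q) \<le> \<psi> q / 1" using q \<psi>0 Log_ge_1[of "real q"] by (intro frac_le) auto
          also have "\<dots> \<le> (if q \<in> {1..q1} then \<psi> q else 0) + 1" using q q1[of q] by auto
          finally show "\<psi> q / Log (real q) \<le> (if q \<in> {1..q1} then \<psi> q else 0) + 1" .
        qed
        also have "\<dots> = (\<Sum>q\<in>{1..u}. if q \<in> {1..q1} then \<psi> q else 0) + u" by (simp add: sum.distrib)
        also have "(\<Sum>q\<in>{1..u}. if q \<in> {1..q1} then \<psi> q else 0) = (\<Sum>q\<in>{1..u} \<inter> {1..q1}. \<psi> q)"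
          by (rule sum.inter_restrict[symmetric]) simp
        also have "\<dots> \<le> Cs" unfolding Cs_def using \<psi>0 by (intro sum_mono2) auto
        finally show ?thesis by simp
      qed
      \<comment> \<open>Points of the unit interval without any solution
        \<open>q \<ge> max 1 m\<close>; the union over \<open>m\<close> contains every exceptional
        point of [0, 1).\<close>
      define Z where "Z = (\<lambda>m. {x \<in> {0..<1}. \<forall>q\<ge>max 1 m. \<psi> q < dist_int (real q * x - \<gamma>)})"
      have "Z m \<in> null_sets lborel" for m
      proof (rule null_set_if_avoids_spread_families[where 'i = "nat \<times> int" and c = "exp (- 144) / 8"])
        have "Z m = {0..<1} \<inter> (\<Inter>q\<in>{max 1 m..}. {x. \<psi> q < dist_int (real q * x - \<gamma>)})" by (auto simp: Z_def)
        moreover have "{x. \<psi> q < dist_int (real q * x - \<gamma>)} \<in> sets borel" for q by measurable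
        ultimately show "Z m \<in> sets borel" by (simp add: sets.countable_INT'')
        show "Z m \<subseteq> {0..<1}" by (auto simp: Z_def)
        show "(0::real) < exp (- 144) / 8" by simp
        fix N :: nat assume N: "N > 0"
        have "exp (- 144) / (8 * real N) > 0" using N by simp
        from eventually_sieve_error_le[OF this] obtain q0 where q0: "\<And>q. q \<ge> q0 \<Longrightarrow>
            4 * sqrt (real q) * (1 + ln (real q)) \<le> exp (- 144) / (8 * N) * real q"
          unfolding eventually_sequentially by auto
        from c(2) obtain Q0 where Q0: "\<And>Q. Q \<ge> Q0 \<Longrightarrow> c * f Q \<le> (\<Sum>q\<in>{1..Q}. \<psi> q / Log (real q))"
          unfolding eventually_sequentially by auto
        \<comment> \<open>Collects all thresholds depending on \<open>m\<close>, \<open>N\<close>,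
          \<open>f\<close> and \<open>\<psi>\<close>; the last summand secures
          \<open>c * j \<ge> Cs + 5\<close>.\<close>
        define j where "j = m + q1 + N + q0 + Q0 + nat \<lceil>(Cs + 5) / c\<rceil>"
        have "(Cs + 5) / c \<le> real j" unfolding j_def by linarith
        then have cj: "Cs + 5 \<le> c * j" using c(1) by (simp add: pos_divide_le_eq mult.commute)
        define u where "u = U j (n j)"
        define v where "v = V j (n j)"
        have st: "j \<le> u" "3 \<le> u" "real j * (real u + 1) \<le> f v" "j \<le> v"
          "\<And>q k. u < q \<Longrightarrow> ln (real q) < 4 ^ (k + 1) \<Longrightarrow> 32 \<le> k \<and> C (n j) \<le> 2 ^ k"
          using UV[of j "n j"] unfolding stage_def u_def[symmetric] v_def[symmetric] by auto
        have big: "m \<le> q" "q1 \<le> q" "N \<le> q" "q0 \<le> q" "3 \<le> q" if "u < q" for q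
          using that st(1,2) by (auto simp: j_def)
        define r :: int where "r = 2 ^ n j"
        obtain a :: int where a: "odd a" "0 < \<gamma> - a / 2 ^ n j" "\<gamma> - a / 2 ^ n j \<le> 2 * (1 / 2) ^ n (Suc j)"
          using approx by blast
        have "n j \<ge> 1" by (cases j) (simp_all add: n)
        then have r: "r \<ge> 2" "coprime a r"
          using a(1) power_increasing[of 1 "n j" "2::int"] by (auto simp: r_def coprime_commute)

        \<comment> \<open>Values of \<open>\<psi>\<close> below \<open>1 / q\<^sup>2\<close> have
          total mass at most 2 and are dropped. For the others \<open>\<psi> q / 2\<close> dominates
          the error of replacing \<open>\<gamma>\<close> by \<open>a / r\<close>.\<close>
        define W where "W = {q \<in> {u<..v}. 1 / (real q)\<^sup>2 \<le> \<psi> q}"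
        \<comment> \<open>Beyond \<open>u \<ge> 3\<close> one has \<open>q \<ge> exp 1\<close>, so
          the truncation in \<open>Log\<close> has no effect.\<close>
        have Log_eq: "Log (real q) = ln (real q)" "1 \<le> ln (real q)" if "u < q" for q
        proof -
          have "exp 1 \<le> real q" using exp_le big(5)[OF that] by linarith
          then have "ln (exp 1) \<le> ln (real q)" by (intro ln_mono) auto
          then show "1 \<le> ln (real q)" by simp
          then show "Log (real q) = ln (real q)" by (simp add: Log_def)
        qed
        \<comment> \<open>The total up to \<open>v\<close> is at least
          \<open>(Cs + 5) * (u + 1)\<close>, of which \<open>q \<le> u\<close> accounts for at most
          \<open>Cs + u\<close> and the dropped terms for at most 2. At least
          \<open>Cs * u + 4 * u + 3\<close> is left for \<open>W\<close>.\<close>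
        have "2 < (\<Sum>q\<in>W. \<psi> q / ln (real q))"
        proof -
          have "(Cs + 5) * (real u + 1) \<le> c * j * (real u + 1)" using cj by (intro mult_right_mono) auto
          also have "\<dots> \<le> c * f v" using st(3) c(1) by (simp add: mult.assoc)
          also have "\<dots> \<le> (\<Sum>q\<in>{1..v}. \<psi> q / Log (real q))" using st(4) by (intro Q0) (simp add: j_def)
          also have "\<dots> \<le> (\<Sum>q\<in>{1..u} \<union> W \<union> ({u<..v} - W). \<psi> q / Log (real q))"
          proof (rule sum_mono2)
            show "finite ({1..u} \<union> W \<union> ({u<..v} - W))" by (simp add: W_def)
            show "0 \<le> \<psi> b / Log (real b)" if "b \<in> {1..u} \<union> W \<union> ({u<..v} - W) - {1..v}" for b
              using that \<psi>0 Log_ge_1[of "real b"] by (intro divide_nonneg_nonneg) (auto simp: W_def)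
          qed (auto simp: W_def)
          also have "\<dots> = (\<Sum>q\<in>{1..u}. \<psi> q / Log (real q)) + (\<Sum>q\<in>W. \<psi> q / Log (real q))
             + (\<Sum>q\<in>{u<..v} - W. \<psi> q / Log (real q))"
            by (subst sum.union_disjoint, (auto simp: W_def)[3], subst sum.union_disjoint) (auto simp: W_def)
          also have "(\<Sum>q\<in>{u<..v} - W. \<psi> q / Log (real q)) \<le> (\<Sum>q\<in>{u<..v} - W. 1 / (real q)\<^sup>2)"
          proof (rule sum_mono)
            fix q assume q: "q \<in> {u<..v} - W"
            then have "\<psi> q / Log (real q) \<le> \<psi> q / 1" using \<psi>0 Log_ge_1[of "real q"] by (intro frac_le) auto
            also have "\<dots> \<le> 1 / (real q)\<^sup>2" using q by (auto simp: W_def)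
            finally show "\<psi> q / Log (real q) \<le> 1 / (real q)\<^sup>2" .
          qed
          also have "(\<Sum>q\<in>{u<..v} - W. 1 / (real q)\<^sup>2) \<le> (\<Sum>q=1..v. 1 / (real q)\<^sup>2)" by (intro sum_mono2) auto
          also have "\<dots> \<le> 2" by (rule sum_inverse_squares_le)
          also have "(\<Sum>q\<in>{1..u}. \<psi> q / Log (real q)) \<le> Cs + u" by (rule early)
          also have "(\<Sum>q\<in>W. \<psi> q / Log (real q)) = (\<Sum>q\<in>W. \<psi> q / ln (real q))"
            by (intro sum.cong refl) (auto simp: W_def Log_eq)
          finally have "(Cs + 5) * (real u + 1) \<le> Cs + u + (\<Sum>q\<in>W. \<psi> q / ln (real q)) + 2" by simp
          moreover have "0 \<le> Cs * real u" using Cs0 by simp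
          ultimately show ?thesis by (simp add: algebra_simps)
        qed
        then obtain k where k: "2 ^ k \<le> (\<Sum>q | q \<in> W \<and> 4 ^ k \<le> ln (real q) \<and> ln (real q) < 4 ^ (k + 1). \<psi> q)"
          using exists_heavy_block[of W \<psi>] Log_eq(2) \<psi>0 by (auto simp: W_def)
        define B where "B = {q. q \<in> W \<and> 4 ^ k \<le> ln (real q) \<and> ln (real q) < 4 ^ (k + 1)}"
        have B: "u < q" "q \<le> v" "1 / (real q)\<^sup>2 \<le> \<psi> q" "4 ^ k \<le> ln (real q)" "ln (real q) < 4 ^ (k + 1)" if "q \<in> B" for q
          using that by (auto simp: B_def W_def)
        \<comment> \<open>A member of \<open>B\<close> exceeds \<open>u\<close> and lies in block
          \<open>k\<close>, which is what the stage needs in order to bound \<open>k\<close> from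
          below.\<close>
        have "B \<noteq> {}"
        proof
          assume "B = {}"
          then have "(2::real) ^ k \<le> 0" using k unfolding B_def[symmetric] by simp
          moreover have "(0::real) < 2 ^ k" by simp
          ultimately show False by linarith
        qed
        then have k32: "32 \<le> k" "(2 * real_of_int r ^ nat r)\<^sup>2 \<le> 2 ^ k"
          using st(5) B unfolding C_def r_def by blast+
        have psipos: "0 < \<psi> q" if "q \<in> B" for q
        proof -
          have "0 < 1 / (real q)\<^sup>2" using big(5)[OF B(1)[OF that]] by simp
          then show ?thesis using B(3)[OF that] by linarith
        qed
        have psihalf: "\<psi> q \<le> 1 / 2" if "q \<in> B" for q
          using q1[of q] big[OF B(1)[OF that]] by simp
        have "finite B" by (simp add: B_def W_def)
        have NB: "N \<le> q" if "q \<in> B" for q using big(3)[OF B(1)[OF that]] .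
        have err: "4 * sqrt (real q) * (1 + ln (real q)) \<le> exp (- 144) / (8 * N) * real q" if "q \<in> B" for q
          using q0[OF big(4)[OF B(1)[OF that]]] .
        have "\<exists>(X :: (nat \<times> int) set) A S. finite X \<and> S > 0
          \<and> (\<forall>i\<in>X. A i \<in> fmeasurable lborel \<and>
              (\<forall>x\<in>A i. \<exists>q\<in>B. \<exists>t::int. \<bar>real q * x - real_of_int a / real_of_int r - real_of_int t\<bar> \<le> \<psi> q / 2))
          \<and> (\<Sum>i\<in>X. \<Sum>j\<in>X. measure lborel (A i \<inter> A j)) \<le> 5 * S\<^sup>2
          \<and> (\<forall>l<N. exp (- 144) / 8 * S / N \<le> (\<Sum>i\<in>X. measure lborel (A i \<inter> {real l / N..<(real l + 1) / N})))"
          by (rule exists_spread_family[where a = a and r = r and k = k and N = N and B = B and \<psi> = \<psi>,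
                OF r k32 N \<open>finite B\<close> B(4,5) psipos psihalf k[folded B_def] NB err])
        then obtain X :: "(nat \<times> int) set" and A S where fam: "finite X \<and> S > 0
          \<and> (\<forall>i\<in>X. A i \<in> fmeasurable lborel \<and>
              (\<forall>x\<in>A i. \<exists>q\<in>B. \<exists>t::int. \<bar>real q * x - real_of_int a / real_of_int r - real_of_int t\<bar> \<le> \<psi> q / 2))
          \<and> (\<Sum>i\<in>X. \<Sum>j\<in>X. measure lborel (A i \<inter> A j)) \<le> 5 * S\<^sup>2
          \<and> (\<forall>l<N. exp (- 144) / 8 * S / N \<le> (\<Sum>i\<in>X. measure lborel (A i \<inter> {real l / N..<(real l + 1) / N})))"
          by (elim exE) (rule that)
        from fam have near: "\<forall>i\<in>X. A i \<in> fmeasurable lborel \<and>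
              (\<forall>x\<in>A i. \<exists>q\<in>B. \<exists>t::int. \<bar>real q * x - real_of_int a / real_of_int r - real_of_int t\<bar> \<le> \<psi> q / 2)"
          by (elim conjE)
        have "A i \<inter> Z m = {}" if "i \<in> X" for i
        proof (rule equals0I)
          fix x assume x: "x \<in> A i \<inter> Z m"
          from near[rule_format, OF that, THEN conjunct2] x
          obtain q and t :: int where q: "q \<in> B" "\<bar>real q * x - real_of_int a / real_of_int r - t\<bar> \<le> \<psi> q / 2"
            by blast
          \<comment> \<open>The exponent \<open>2 * v + 2\<close> gives
            \<open>1 / (2 * (2 ^ v)\<^sup>2)\<close>, and \<open>q \<le> v\<close> turns this into
            at most \<open>\<psi> q / 2\<close>. Added to the \<open>\<psi> q / 2\<close> from the
            family, it stays within \<open>\<psi> q\<close>.\<close>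
          have "\<gamma> - a / r \<le> 1 / (2 * (real v)\<^sup>2)"
          proof -
            have v: "real v > 0" using B(1,2)[OF q(1)] by simp
            have "2 * (1 / 2 :: real) ^ n (Suc j) \<le> 2 * (1 / 2) ^ (2 * v + 2)"
              unfolding n(2) v_def[symmetric] by (intro mult_left_mono power_decreasing) auto
            also have "\<dots> = 1 / (2 * (2 ^ v)\<^sup>2)" by (simp add: power_add power_one_over power_mult[symmetric] mult.commute)
            also have "\<dots> \<le> 1 / (2 * (real v)\<^sup>2)"
              using v of_nat_less_two_power[of v, where 'a = real]
              by (intro divide_left_mono mult_left_mono power_mono) auto
            finally show ?thesis using a(3) by (simp add: r_def)
          qed
          also have "\<dots> \<le> 1 / (2 * (real q)\<^sup>2)"
            using B(1,2)[OF q(1)] by (intro divide_left_mono mult_left_mono power_mono) auto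
          also have "\<dots> \<le> \<psi> q / 2" using B(3)[OF q(1)] by simp
          finally have "\<gamma> - a / r \<le> \<psi> q / 2" .
          moreover have "0 < \<gamma> - a / r" using a(2) by (simp add: r_def)
          ultimately have "\<bar>(real q * x - \<gamma>) - t\<bar> \<le> \<psi> q" using q(2) by linarith
          then have "dist_int (real q * x - \<gamma>) \<le> \<psi> q" using dist_int_le order_trans by blast
          moreover have "\<psi> q < dist_int (real q * x - \<gamma>)"
            using x big[OF B(1)[OF q(1)]] by (auto simp: Z_def)
          ultimately show False by simp
        qed
        then show "\<exists>(X :: (nat \<times> int) set) A S. finite X \<and> S > 0 \<and> (\<forall>i\<in>X. A i \<in> fmeasurable lborel \<and> A i \<inter> Z m = {})
          \<and> (\<Sum>i\<in>X. \<Sum>j\<in>X. measure lborel (A i \<inter> A j)) \<le> 5 * S\<^sup>2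
          \<and> (\<forall>k<N. exp (- 144) / 8 * S / N \<le> (\<Sum>i\<in>X. measure lborel (A i \<inter> {real k / N..<(real k + 1) / N})))"
          using fam by (intro exI[of _ X] exI[of _ A] exI[of _ S]) (elim conjE, intro conjI, assumption+, blast, assumption+)
      qed
      then have null: "(\<Union>m. Z m) \<in> null_sets lborel" by (intro null_sets_UN)
      let ?Bad = "{x. finite {q. q \<ge> 1 \<and> dist_int (real q * x - \<gamma>) \<le> \<psi> q}}"
      have "\<exists>N'\<in>null_sets lborel. ?Bad \<subseteq> N'"
      proof (rule null_sets_if_periodic[OF _ null])
        show "?Bad \<inter> {0..<1} \<subseteq> (\<Union>m. Z m)"
        proof
          fix x assume x: "x \<in> ?Bad \<inter> {0..<1}"
          then have "finite {q. q \<ge> 1 \<and> dist_int (real q * x - \<gamma>) \<le> \<psi> q}" by blast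
          from this[unfolded finite_nat_set_iff_bounded]
          obtain m where m: "\<forall>q\<in>{q. q \<ge> 1 \<and> dist_int (real q * x - \<gamma>) \<le> \<psi> q}. q < m" ..
          have "\<psi> q < dist_int (real q * x - \<gamma>)" if q: "max 1 m \<le> q" for q
          proof (rule ccontr)
            assume "\<not> \<psi> q < dist_int (real q * x - \<gamma>)"
            then have "q \<in> {q. q \<ge> 1 \<and> dist_int (real q * x - \<gamma>) \<le> \<psi> q}" using q by auto
            with m have "q < m" by blast
            with q show False by simp
          qed
          then have "x \<in> Z m" using x by (auto simp: Z_def)
          then show "x \<in> (\<Union>m. Z m)" by blast
        qed
        fix x t assume "x \<in> ?Bad"
        moreover have "dist_int (real q * (x - of_int t) - \<gamma>) = dist_int (real q * x - \<gamma>)" for q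
          using dist_int_add_int[of "real q * x - \<gamma>" "- (int q * t)"] by (simp add: algebra_simps)
        ultimately show "x - of_int t \<in> ?Bad" by simp
      qed
      then obtain N' where N': "N' \<in> null_sets lborel" "?Bad \<subseteq> N'" by blast
      show ?thesis by (rule AE_I'[OF N'(1)]) (use N'(2) in auto)
    qed
  qed
  ultimately show ?thesis by blast
qed

end
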